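(* Let $n\ge 2$ and let $X$ be a conjugacy class of involutions in $G_n$ with labelled cycle type $(m,k_e,k_o,l)$. Then the commuting graph $\mathcal{C}(G_n,X)$ is disconnected in each of the following cases: (i) $m=0$ and $l=0$; (ii) $m>0$, $l=0$ and either $k_e=1$ or $k_o=1$; (iii) $m>0$ and $\max(k_e,k_o,l)=1$; (iv) $n=4$ and $m=1$; (v) $n=6$, $m=1$ and $k_e=k_o=2$. In all other cases, $\mathcal{C}(G_n,X)$ is connected.
   Context: For $n\ge 2$, let $W_n$ be the Coxeter (Weyl) group of type $C_n$, i.e. the group of signed permutations acting (on the right) on $\mathbb{R}^n$ by permuting the subscripts of the standard basis vectors $e_1,\dots,e_n$ and changing their signs; write $i^{\sigma}=\pm j$ when $e_i^{\sigma}=\pm e_j$. $G_n$ is the affine Weyl group of type $\tilde C_n$, the semidirect product of $W_n$ with $\mathbb{Z}^n$: its elements are pairs $(\sigma,\mathbf v)$ with $\sigma\in W_n$, $\mathbf v=(v_1,\dots,v_n)\in\mathbb{Z}^n$, and the product is $(\alpha,\mathbf v)(\tau,\mathbf u)=(\alpha\tau,\mathbf v^{\tau}+\mathbf u)$. An involution is an element of order exactly 2. If $(\sigma,\mathbf v)$ is an involution, then every cycle of the permutation underlying $\sigma$ has length 1 or 2. The labelled cycle type of the involution $(\sigma,\mathbf v)$ is the quadruple $(m,k_e,k_o,l)$, where $m$ is the number of 2-cycles (transpositions) of the underlying permutation, $k_e$ (respectively $k_o$) is the number of $i\in\{1,\dots,n\}$ with $i^{\sigma}=-i$ and $v_i$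 even (respectively odd), and $l$ is the number of $i$ with $i^{\sigma}=i$; so $2m+k_e+k_o+l=n$. All elements of a conjugacy class of involutions have the same labelled cycle type, which is called the labelled cycle type of the class. The commuting graph $\mathcal{C}(G_n,X)$ has vertex set $X$, with two distinct vertices $x,y$ joined by an edge whenever $xy=yx$. *)

theory Defs
  imports
    "HOL-Algebra.Multiplicative_Group"
    "HOL-Combinatorics.Permutations"
    "Graph_Theory.Graph_Theory"
begin

text \<open>
  The basis vectors \<open>e\<^sub>1, \<dots>, e\<^sub>n\<close> and their negatives are labelled by the integers
  \<open>\<plusminus>1, \<dots>, \<plusminus>n\<close>, with \<open>e\<close> at \<open>-i\<close> being \<open>-e\<^sub>i\<close>. A signed permutation is then a permutation \<open>\<sigma>\<close>
  of these labels with \<open>\<sigma> (- i) = - \<sigma> i\<close>, and \<open>\<sigma> i = \<plusminus> j\<close> says that \<open>\<sigma>\<close> sends \<open>e\<^sub>i\<close> to \<open>\<plusminus>e\<^sub>j\<close>.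
\<close>

definition signed_perms :: "nat \<Rightarrow> (int \<Rightarrow> int) set" where
  "signed_perms n = {\<sigma>. \<sigma> permutes {k. k \<noteq> 0 \<and> \<bar>k\<bar> \<le> int n} \<and> (\<forall>k. \<sigma> (- k) = - \<sigma> k)}"

definition int_vectors :: "nat \<Rightarrow> (int \<Rightarrow> int) set" where
  "int_vectors n = {v. \<forall>i. i \<notin> {1..int n} \<longrightarrow> v i = 0}"

definition signed_basis :: "int \<Rightarrow> int \<Rightarrow> int" where
  "signed_basis k = (\<lambda>j. if j = \<bar>k\<bar> then sgn k else 0)"

definition vec_act :: "nat \<Rightarrow> (int \<Rightarrow> int) \<Rightarrow> (int \<Rightarrow> int) \<Rightarrow> (int \<Rightarrow> int)" where
  "vec_act n \<sigma> v = (\<lambda>j. \<Sum>i\<in>{1..int n}. v i * signed_basis (\<sigma> i) j)"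

text \<open>
  Signed permutations act on the right, so the product \<open>\<alpha>\<tau>\<close> means first \<open>\<alpha>\<close>, then \<open>\<tau>\<close>.
\<close>

definition affine_C :: "nat \<Rightarrow> ((int \<Rightarrow> int) \<times> (int \<Rightarrow> int)) monoid" where
  "affine_C n =
     \<lparr> carrier = signed_perms n \<times> int_vectors n,
       monoid.mult = (\<lambda>(\<alpha>, v) (\<tau>, u). (\<tau> \<circ> \<alpha>, \<lambda>i. vec_act n \<tau> v i + u i)),
       one = (id, \<lambda>i. 0) \<rparr>"

definition conjugacy_class :: "('a, 'b) monoid_scheme \<Rightarrow> 'a \<Rightarrow> 'a set" where
  "conjugacy_class G x = {inv\<^bsub>G\<^esub> g \<otimes>\<^bsub>G\<^esub> x \<otimes>\<^bsub>G\<^esub> g | g. g \<in> carrier G}"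

definition commuting_graph :: "('a, 'b) monoid_scheme \<Rightarrow> 'a set \<Rightarrow> 'a pair_pre_digraph" where
  "commuting_graph G X =
     \<lparr> pverts = X,
       parcs = {(x, y). x \<in> X \<and> y \<in> X \<and> x \<noteq> y \<and> x \<otimes>\<^bsub>G\<^esub> y = y \<otimes>\<^bsub>G\<^esub> x} \<rparr>"

text \<open>
  The permutation of \<open>{1..n}\<close> underlying \<open>\<sigma>\<close> is \<open>i \<mapsto> \<bar>\<sigma> i\<bar>\<close>; a 2-cycle is represented by its
  support.
\<close>

definition two_cycles :: "nat \<Rightarrow> (int \<Rightarrow> int) \<Rightarrow> int set set" where
  "two_cycles n \<sigma> =
     {{i, j} | i j. i \<in> {1..int n} \<and> j \<in> {1..int n} \<and> i \<noteq> j \<and> \<bar>\<sigma> i\<bar> = j \<and> \<bar>\<sigma> j\<bar> = i}"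

definition labelled_cycle_type ::
    "nat \<Rightarrow> (int \<Rightarrow> int) \<times> (int \<Rightarrow> int) \<Rightarrow> nat \<times> nat \<times> nat \<times> nat" where
  "labelled_cycle_type n = (\<lambda>(\<sigma>, v).
     (card (two_cycles n \<sigma>),
      card {i \<in> {1..int n}. \<sigma> i = - i \<and> even (v i)},
      card {i \<in> {1..int n}. \<sigma> i = - i \<and> odd (v i)},
      card {i \<in> {1..int n}. \<sigma> i = i}))"

lemma signed_perms_neg: "\<sigma> \<in> signed_perms n \<Longrightarrow> \<sigma> (- k) = - \<sigma> k"
  by (simp add: signed_perms_def)

lemma signed_perms_inj: "\<sigma> \<in> signed_perms n \<Longrightarrow> \<sigma> a = \<sigma> b \<longleftrightarrow> a = b"
  unfolding signed_perms_def by (blast dest: permutes_inj injD)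

lemma signed_perms_abs_range:
  assumes "\<sigma> \<in> signed_perms n" "i \<in> {1..int n}"
  shows "\<bar>\<sigma> i\<bar> \<in> {1..int n}" "\<sigma> i \<noteq> 0"
proof -
  from assms have "\<sigma> i \<in> {k. k \<noteq> 0 \<and> \<bar>k\<bar> \<le> int n}"
    by (subst permutes_in_image) (auto simp: signed_perms_def)
  then show "\<bar>\<sigma> i\<bar> \<in> {1..int n}" "\<sigma> i \<noteq> 0" by auto
qed

lemma signed_perms_abs_inj:
  assumes "\<sigma> \<in> signed_perms n"
  shows "inj_on (\<lambda>i. \<bar>\<sigma> i\<bar>) {1..int n}"
proof (rule inj_onI)
  fix a b assume ab: "a \<in> {1..int n}" "b \<in> {1..int n}" "\<bar>\<sigma> a\<bar> = \<bar>\<sigma> b\<bar>"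
  then have "\<sigma> a = \<sigma> b \<or> \<sigma> a = \<sigma> (- b)"
    using signed_perms_neg[OF assms] by (metis abs_eq_iff)
  with ab show "a = b"
    by (auto simp: signed_perms_inj[OF assms])
qed

lemma vec_act_at:
  assumes "\<sigma> \<in> signed_perms n" "i \<in> {1..int n}"
  shows "vec_act n \<sigma> v \<bar>\<sigma> i\<bar> = sgn (\<sigma> i) * v i"
proof -
  have "vec_act n \<sigma> v \<bar>\<sigma> i\<bar> = (\<Sum>k\<in>{1..int n}. if k = i then v k * sgn (\<sigma> k) else 0)"
    unfolding vec_act_def signed_basis_def
    by (rule sum.cong)
      (use inj_on_eq_iff[OF signed_perms_abs_inj[OF assms(1)] assms(2)] in auto)
  then show ?thesis using assms(2) by simp
qed

lemma vec_act_in: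
  assumes "\<sigma> \<in> signed_perms n"
  shows "vec_act n \<sigma> v \<in> int_vectors n"
proof -
  have "vec_act n \<sigma> v j = 0" if "j \<notin> {1..int n}" for j
    unfolding vec_act_def
  proof (rule sum.neutral, rule ballI)
    fix i assume "i \<in> {1..int n}"
    then have "j \<noteq> \<bar>\<sigma> i\<bar>" using signed_perms_abs_range(1)[OF assms] that by blast
    then show "v i * signed_basis (\<sigma> i) j = 0" by (simp add: signed_basis_def)
  qed
  then show ?thesis by (simp add: int_vectors_def)
qed

lemma vec_act_id: "v \<in> int_vectors n \<Longrightarrow> vec_act n id v = v"
proof
  fix j assume v: "v \<in> int_vectors n"
  show "vec_act n id v j = v j"
  proof (cases "j \<in> {1..int n}")
    case True
    then show ?thesis
      using vec_act_at[of id n j v] by (auto simp: signed_perms_def permutes_id)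
  next
    case False
    then show ?thesis
      using v vec_act_in[of id n v] by (auto simp: signed_perms_def permutes_id int_vectors_def)
  qed
qed

lemma vec_act_add: "vec_act n \<sigma> (\<lambda>i. u i + v i) = (\<lambda>i. vec_act n \<sigma> u i + vec_act n \<sigma> v i)"
  by (simp add: vec_act_def sum.distrib algebra_simps)

lemma signed_perms_comp:
  "\<sigma> \<in> signed_perms n \<Longrightarrow> \<tau> \<in> signed_perms n \<Longrightarrow> \<tau> \<circ> \<sigma> \<in> signed_perms n"
  by (auto simp: signed_perms_def intro: permutes_compose)

lemma signed_perms_inv:
  assumes "\<sigma> \<in> signed_perms n"
  shows "Hilbert_Choice.inv \<sigma> \<in> signed_perms n"
proof -
  have p: "\<sigma> permutes {k. k \<noteq> 0 \<and> \<bar>k\<bar> \<le> int n}"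
    using assms by (simp add: signed_perms_def)
  have "Hilbert_Choice.inv \<sigma> (- k) = - Hilbert_Choice.inv \<sigma> k" for k
    using permutes_inverses[OF p] signed_perms_neg[OF assms] signed_perms_inj[OF assms]
    by metis
  then show ?thesis using permutes_inv[OF p] by (simp add: signed_perms_def)
qed

lemma vec_act_signed_basis:
  assumes "\<tau> \<in> signed_perms n" "k \<noteq> 0" "\<bar>k\<bar> \<le> int n"
  shows "vec_act n \<tau> (signed_basis k) = signed_basis (\<tau> k)"
proof
  fix j
  have "vec_act n \<tau> (signed_basis k) j =
      (\<Sum>i\<in>{1..int n}. if i = \<bar>k\<bar> then sgn k * signed_basis (\<tau> i) j else 0)"
    unfolding vec_act_def by (rule sum.cong) (auto simp: signed_basis_def)
  also have "\<dots> = sgn k * signed_basis (\<tau> \<bar>k\<bar>) j"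
    using assms(2,3) by (subst sum.delta) auto
  also have "\<dots> = signed_basis (\<tau> k) j"
    using assms(2) signed_perms_neg[OF assms(1), of k]
    by (cases "k > 0") (auto simp: signed_basis_def sgn_minus abs_if)
  finally show "vec_act n \<tau> (signed_basis k) j = signed_basis (\<tau> k) j" .
qed

lemma vec_act_comp:
  assumes "\<sigma> \<in> signed_perms n" "\<tau> \<in> signed_perms n"
  shows "vec_act n \<tau> (vec_act n \<sigma> v) = vec_act n (\<tau> \<circ> \<sigma>) v"
proof
  fix j
  have "vec_act n \<tau> (vec_act n \<sigma> v) j =
      (\<Sum>k\<in>{1..int n}. v k * vec_act n \<tau> (signed_basis (\<sigma> k)) j)"
    unfolding vec_act_def sum_distrib_right sum_distrib_left
    by (subst sum.swap) (simp add: mult.assoc)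
  also have "\<dots> = (\<Sum>k\<in>{1..int n}. v k * signed_basis (\<tau> (\<sigma> k)) j)"
    using signed_perms_abs_range[OF assms(1)]
    by (intro sum.cong) (simp_all add: vec_act_signed_basis[OF assms(2)])
  finally show "vec_act n \<tau> (vec_act n \<sigma> v) j = vec_act n (\<tau> \<circ> \<sigma>) v j"
    by (simp add: vec_act_def)
qed

lemma id_signed_perms: "id \<in> signed_perms n"
  by (simp add: signed_perms_def permutes_id)

lemma int_vectors_add: "u \<in> int_vectors n \<Longrightarrow> v \<in> int_vectors n \<Longrightarrow> (\<lambda>i. u i + v i) \<in> int_vectors n"
  by (simp add: int_vectors_def)

theorem group_affine_C: "group (affine_C n)"
proof (rule groupI)
  show "\<one>\<^bsub>affine_C n\<^esub> \<in> carrier (affine_C n)"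
    by (simp add: affine_C_def id_signed_perms int_vectors_def)
next
  fix x y assume "x \<in> carrier (affine_C n)" "y \<in> carrier (affine_C n)"
  then show "x \<otimes>\<^bsub>affine_C n\<^esub> y \<in> carrier (affine_C n)"
    by (auto simp: affine_C_def intro!: signed_perms_comp int_vectors_add vec_act_in)
next
  fix x y z
  assume "x \<in> carrier (affine_C n)" "y \<in> carrier (affine_C n)" "z \<in> carrier (affine_C n)"
  then show "x \<otimes>\<^bsub>affine_C n\<^esub> y \<otimes>\<^bsub>affine_C n\<^esub> z = x \<otimes>\<^bsub>affine_C n\<^esub> (y \<otimes>\<^bsub>affine_C n\<^esub> z)"
    by (auto simp: affine_C_def vec_act_add vec_act_comp comp_assoc add.assoc)
next
  fix x assume "x \<in> carrier (affine_C n)"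
  then show "\<one>\<^bsub>affine_C n\<^esub> \<otimes>\<^bsub>affine_C n\<^esub> x = x"
    by (auto simp: affine_C_def vec_act_def)
next
  fix x assume "x \<in> carrier (affine_C n)"
  then obtain \<sigma> v where x: "x = (\<sigma>, v)" and s: "\<sigma> \<in> signed_perms n" and v: "v \<in> int_vectors n"
    by (auto simp: affine_C_def)
  let ?t = "Hilbert_Choice.inv \<sigma>"
  have t: "?t \<in> signed_perms n" by (rule signed_perms_inv[OF s])
  have "\<sigma> \<circ> ?t = id"
    using s by (auto simp: signed_perms_def intro: permutes_inv_o)
  moreover have "vec_act n \<sigma> (vec_act n ?t (\<lambda>i. - v i)) = (\<lambda>i. - v i)"
    using v by (simp add: vec_act_comp s t calculation vec_act_id int_vectors_def)
  ultimately have "(?t, vec_act n ?t (\<lambda>i. - v i)) \<otimes>\<^bsub>affine_C n\<^esub> x = \<one>\<^bsub>affine_C n\<^esub>"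
    by (simp add: x affine_C_def)
  moreover have "(?t, vec_act n ?t (\<lambda>i. - v i)) \<in> carrier (affine_C n)"
    by (simp add: affine_C_def t vec_act_in)
  ultimately show "\<exists>y\<in>carrier (affine_C n). y \<otimes>\<^bsub>affine_C n\<^esub> x = \<one>\<^bsub>affine_C n\<^esub>" by blast
qed

lemma labelled_cycle_sets_conj:
  assumes g: "\<tau> \<in> signed_perms n" and s: "\<sigma>' \<in> signed_perms n"
    and perm: "\<sigma>' \<circ> \<tau> = \<tau> \<circ> \<sigma>"
    and vec: "\<And>j. vec_act n \<sigma>' u j + v' j = vec_act n \<tau> v j + u j"
  shows "card (two_cycles n \<sigma>) \<le> card (two_cycles n \<sigma>')"
    and "card {i \<in> {1..int n}. \<sigma> i = - i \<and> even (v i)}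
          \<le> card {i \<in> {1..int n}. \<sigma>' i = - i \<and> even (v' i)}"
    and "card {i \<in> {1..int n}. \<sigma> i = - i \<and> odd (v i)}
          \<le> card {i \<in> {1..int n}. \<sigma>' i = - i \<and> odd (v' i)}"
    and "card {i \<in> {1..int n}. \<sigma> i = i} \<le> card {i \<in> {1..int n}. \<sigma>' i = i}"
proof -
  let ?f = "\<lambda>i. \<bar>\<tau> i\<bar>"
  have inj: "inj_on ?f {1..int n}" by (rule signed_perms_abs_inj[OF g])
  have st: "\<sigma>' (\<tau> i) = \<tau> (\<sigma> i)" for i using perm by (metis comp_apply)
  have abs_abs: "\<bar>\<sigma>' \<bar>k\<bar>\<bar> = \<bar>\<sigma>' k\<bar>" "\<bar>\<tau> \<bar>k\<bar>\<bar> = \<bar>\<tau> k\<bar>" for k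
    using signed_perms_neg[OF s, of k] signed_perms_neg[OF g, of k] by (auto simp: abs_if)
  have neg: "\<sigma>' (?f i) = - ?f i" if "\<sigma> i = - i" for i
    using st[of i] that signed_perms_neg[OF g, of i] signed_perms_neg[OF s, of "\<tau> i"]
    by (auto simp: abs_if)
  have fixed: "\<sigma>' (?f i) = ?f i" if "\<sigma> i = i" for i
    using st[of i] that signed_perms_neg[OF s, of "\<tau> i"] by (auto simp: abs_if)
  have par: "even (v' (?f i)) \<longleftrightarrow> even (v i)" if i: "i \<in> {1..int n}" "\<sigma> i = - i" for i
  proof -
    have j: "?f i \<in> {1..int n}" "\<tau> i \<noteq> 0" by (fact signed_perms_abs_range[OF g i(1)])+
    have "\<bar>\<sigma>' (?f i)\<bar> = ?f i" "sgn (\<sigma>' (?f i)) = -1" using neg[OF i(2)] j by auto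
    then have "vec_act n \<sigma>' u (?f i) = - u (?f i)"
      using vec_act_at[OF s j(1), of u] by simp
    then have "v' (?f i) = sgn (\<tau> i) * v i + 2 * u (?f i)"
      using vec[of "?f i"] vec_act_at[OF g i(1), of v] by simp
    then show ?thesis using j(2) by (simp add: sgn_if)
  qed
  have rng: "?f i \<in> {1..int n}" if "i \<in> {1..int n}" for i
    by (rule signed_perms_abs_range[OF g that])
  have two: "?f ` C \<in> two_cycles n \<sigma>'" if "C \<in> two_cycles n \<sigma>" for C
  proof -
    from that obtain i j where C: "C = {i, j}" and ij: "i \<in> {1..int n}" "j \<in> {1..int n}" "i \<noteq> j"
      "\<bar>\<sigma> i\<bar> = j" "\<bar>\<sigma> j\<bar> = i" by (auto simp: two_cycles_def)
    have "\<bar>\<sigma>' (?f i)\<bar> = ?f j" "\<bar>\<sigma>' (?f j)\<bar> = ?f i"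
      using ij(4,5) abs_abs st by metis+
    moreover have "?f i \<noteq> ?f j" using inj ij(1-3) by (auto dest: inj_onD)
    ultimately show ?thesis
      unfolding two_cycles_def C using rng[OF ij(1)] rng[OF ij(2)] by blast
  qed
  have fin: "finite (two_cycles n \<sigma>')"
    by (rule finite_subset[of _ "Pow {1..int n}"]) (auto simp: two_cycles_def)
  show "card (two_cycles n \<sigma>) \<le> card (two_cycles n \<sigma>')"
    by (rule card_inj_on_le[where f = "image ?f", OF _ _ fin])
      (rule inj_on_subset[OF inj_on_image_Pow[OF inj]], auto simp: two,
       auto simp: two_cycles_def)
  show "card {i \<in> {1..int n}. \<sigma> i = - i \<and> even (v i)}
          \<le> card {i \<in> {1..int n}. \<sigma>' i = - i \<and> even (v' i)}"
    using neg par rng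
    by (intro card_inj_on_le[where f = ?f] inj_on_subset[OF inj])
      (auto simp del: atLeastAtMost_iff)
  show "card {i \<in> {1..int n}. \<sigma> i = - i \<and> odd (v i)}
          \<le> card {i \<in> {1..int n}. \<sigma>' i = - i \<and> odd (v' i)}"
    using neg par rng
    by (intro card_inj_on_le[where f = ?f] inj_on_subset[OF inj])
      (auto simp del: atLeastAtMost_iff)
  show "card {i \<in> {1..int n}. \<sigma> i = i} \<le> card {i \<in> {1..int n}. \<sigma>' i = i}"
    using fixed rng
    by (intro card_inj_on_le[where f = ?f] inj_on_subset[OF inj])
      (auto simp del: atLeastAtMost_iff)
qed

theorem labelled_cycle_type_conjugate:
  assumes x: "x \<in> carrier (affine_C n)" and y: "y \<in> conjugacy_class (affine_C n) x"
  shows "labelled_cycle_type n y = labelled_cycle_type n x"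
proof -
  interpret group "affine_C n" by (rule group_affine_C)
  have le: "\<And>\<tau> u \<sigma> v \<sigma>' v'. (\<tau>, u) \<otimes>\<^bsub>affine_C n\<^esub> (\<sigma>', v') = (\<sigma>, v) \<otimes>\<^bsub>affine_C n\<^esub> (\<tau>, u) \<Longrightarrow>
      \<sigma>' \<circ> \<tau> = \<tau> \<circ> \<sigma> \<and> (\<forall>j. vec_act n \<sigma>' u j + v' j = vec_act n \<tau> v j + u j)"
    by (simp add: affine_C_def fun_eq_iff)
  obtain g where g: "g \<in> carrier (affine_C n)"
    and yg: "y = inv\<^bsub>affine_C n\<^esub> g \<otimes>\<^bsub>affine_C n\<^esub> x \<otimes>\<^bsub>affine_C n\<^esub> g"
    using y by (auto simp: conjugacy_class_def)
  have yc: "y \<in> carrier (affine_C n)" using yg g x by simp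
  have 1: "g \<otimes>\<^bsub>affine_C n\<^esub> y = x \<otimes>\<^bsub>affine_C n\<^esub> g"
    using yg g x by (simp add: m_assoc[symmetric])
  have 2: "inv\<^bsub>affine_C n\<^esub> g \<otimes>\<^bsub>affine_C n\<^esub> x = y \<otimes>\<^bsub>affine_C n\<^esub> inv\<^bsub>affine_C n\<^esub> g"
    using yg g x by (simp add: m_assoc)
  obtain \<tau> u \<tau>' u' \<sigma> v \<sigma>' v' where e: "g = (\<tau>, u)" "inv\<^bsub>affine_C n\<^esub> g = (\<tau>', u')"
    "x = (\<sigma>, v)" "y = (\<sigma>', v')" by (metis surj_pair)
  have c: "\<tau> \<in> signed_perms n" "\<tau>' \<in> signed_perms n" "\<sigma> \<in> signed_perms n" "\<sigma>' \<in> signed_perms n"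
    using g[unfolded e(1)] inv_closed[OF g, unfolded e(2)] x[unfolded e(3)] yc[unfolded e(4)]
    by (simp_all add: affine_C_def)
  note A = le[OF 1[unfolded e(1,3,4)]] and B = le[OF 2[unfolded e(2) e(3,4)]]
  show ?thesis
    unfolding e labelled_cycle_type_def
    using labelled_cycle_sets_conj[OF c(1,4), of \<sigma> u v' v] A
      labelled_cycle_sets_conj[OF c(2,3), of \<sigma>' u' v v'] B
    by (simp add: order_antisym)
qed

end

theory Submission
  imports Defs
begin

text \<open>
  Let \<open>H\<close> be the set of \<open>g\<close> such that the conjugate of \<open>x\<close> by \<open>g\<close> lies in the component of \<open>x\<close>.
  Conjugation acts on the commuting graph, so \<open>H\<close> is a subgroup, and the graph is connected iff
  \<open>H\<close> is everything. The group is generated by coordinate transpositions together with one sign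
  change and one unit translation; the last two can always be found in \<open>H\<close> at a coordinate lying in
  a 2-cycle or fixed by \<open>x\<close>. After normalising \<open>x\<close> so that it permutes coordinates without signs,
  apart from reflecting the coordinates in \<open>R\<close> about \<open>0\<close> or (for those in \<open>D\<close>) about \<open>1/2\<close>,
  the relation "the transposition of \<open>i\<close> and \<open>j\<close> lies in \<open>H\<close>" is an equivalence that contains
  all evident commuting exchanges. Exchanging a 2-cycle with two coordinates of one type carries
  this relation from one set of coordinates to another, which makes it total outside the exceptional
  cases. In those cases some datum is common to all commuting conjugates: the involution itself, the
  centre of the unique reflection of its parity, the set of moved coordinates, or a partition of the
  coordinates into pairs.
\<close>

section \<open>Commuting graphs of conjugacy classes\<close>

text \<open>A pair (\<sigma>, v) sends a point w of R^n to w^\<sigma> + v. On a coordinate negated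
  by \<sigma> this is a reflection of a line, with centre half the entry of v. Reflections of a line
  commute only if their centres agree, so coordinates of opposite parity cannot be exchanged
  directly. Nor can one coordinate of a 2-cycle be transposed with an unmoved one: the two 2-cycles
  would share exactly one coordinate and not commute. Only a whole 2-cycle can be exchanged with two
  coordinates of one type, and this is a single element of H rather than two transpositions. To
  extract a transposition from it, a fifth coordinate is needed that is already related to one of
  the four. With one 2-cycle and n = 4 there is none; with one 2-cycle and two reflected coordinates
  of each parity, the two remaining coordinates are known to be related only to each other. This is
  where the two sporadic exceptions come from.\<close>

definition comm_rel :: "('a, 'b) monoid_scheme \<Rightarrow> 'a set \<Rightarrow> ('a \<times> 'a) set" where
  "comm_rel G X = {(x, y). x \<in> X \<and> y \<in> X \<and> x \<otimes>\<^bsub>G\<^esub> y = y \<otimes>\<^bsub>G\<^esub> x}"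

lemma sym_comm_rel: "sym (comm_rel G X)"
  by (auto simp: sym_def comm_rel_def)

text \<open>Commutation is symmetric, so the symmetric closure adds no arcs, and
  \<open>comm_rel\<close> differs from the arcs only by loops, which reachability ignores. The loops
  spare distinctness conditions when paths are transported.\<close>

lemma connected_commuting_graph:
  "connected (with_proj (commuting_graph G X)) \<longleftrightarrow>
    X \<noteq> {} \<and> (\<forall>x\<in>X. \<forall>y\<in>X. (x, y) \<in> (comm_rel G X)\<^sup>*)"
proof -
  let ?E = "parcs (mk_symmetric (with_proj (commuting_graph G X)))"
  have E: "?E = {(x, y). x \<in> X \<and> y \<in> X \<and> x \<noteq> y \<and> x \<otimes>\<^bsub>G\<^esub> y = y \<otimes>\<^bsub>G\<^esub> x}"
    by (auto simp: parcs_mk_symmetric commuting_graph_def)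
  have "(x, y) \<in> rtrancl_on X ?E \<longleftrightarrow> (x, y) \<in> (comm_rel G X)\<^sup>*" if x: "x \<in> X" for x y
  proof
    assume "(x, y) \<in> rtrancl_on X ?E"
    then show "(x, y) \<in> (comm_rel G X)\<^sup>*"
      by (induction rule: rtrancl_on_induct)
        (auto simp: E comm_rel_def intro: rtrancl_into_rtrancl)
  next
    assume "(x, y) \<in> (comm_rel G X)\<^sup>*"
    then show "(x, y) \<in> rtrancl_on X ?E"
    proof induction
      case base
      show ?case by (rule rtrancl_on_refl[OF x])
    next
      case (step y z)
      show ?case
      proof (cases "y = z")
        case False
        with step(2) show ?thesis
          by (intro rtrancl_on_into_rtrancl_on[OF step(3)]) (auto simp: E comm_rel_def)
      qed (use step in simp)
    qed
  qed
  then show ?thesis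
    unfolding connected_def strongly_connected_def reachable_def
    by (auto simp: commuting_graph_def)
qed

section \<open>The subgroup of conjugators that stay in the component\<close>

definition reach_stab :: "('a, 'b) monoid_scheme \<Rightarrow> 'a \<Rightarrow> 'a set" where
  "reach_stab G x = {g \<in> carrier G.
     (x, inv\<^bsub>G\<^esub> g \<otimes>\<^bsub>G\<^esub> x \<otimes>\<^bsub>G\<^esub> g) \<in> (comm_rel G (conjugacy_class G x))\<^sup>*}"

context group
begin

lemma conj_one: "x \<in> carrier G \<Longrightarrow> inv \<one> \<otimes> x \<otimes> \<one> = x"
  by simp

lemma conj_mult:
  "x \<in> carrier G \<Longrightarrow> g \<in> carrier G \<Longrightarrow> h \<in> carrier G \<Longrightarrow>
    inv (g \<otimes> h) \<otimes> x \<otimes> (g \<otimes> h) = inv h \<otimes> (inv g \<otimes> x \<otimes> g) \<otimes> h"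
  by (simp add: m_assoc inv_mult_group)

text \<open>Later conjugacies are verified in the form \<open>g \<otimes> y = x \<otimes> g\<close>,
  which avoids computing inverses in the affine group.\<close>

lemma conj_eq_iff:
  assumes "x \<in> carrier G" "y \<in> carrier G" "g \<in> carrier G"
  shows "inv g \<otimes> x \<otimes> g = y \<longleftrightarrow> g \<otimes> y = x \<otimes> g"
proof -
  have "inv g \<otimes> (x \<otimes> g) = y \<longleftrightarrow> x \<otimes> g = g \<otimes> y"
    using assms by (intro inv_solve_left') auto
  then show ?thesis
    using assms by (metis inv_closed m_assoc)
qed

lemma conj_hom:
  assumes "x \<in> carrier G" "y \<in> carrier G" "g \<in> carrier G"
  shows "inv g \<otimes> (x \<otimes> y) \<otimes> g = (inv g \<otimes> x \<otimes> g) \<otimes> (inv g \<otimes> y \<otimes> g)"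
proof -
  have "g \<otimes> (inv g \<otimes> a) = a" if "a \<in> carrier G" for a
    using that assms by (simp add: m_assoc[symmetric])
  then show ?thesis
    using assms by (simp add: m_assoc)
qed

lemma conjugacy_class_carrier:
  "x \<in> carrier G \<Longrightarrow> y \<in> conjugacy_class G x \<Longrightarrow> y \<in> carrier G"
  by (auto simp: conjugacy_class_def)

lemma conjugacy_class_conj:
  assumes "x \<in> carrier G" "y \<in> conjugacy_class G x" "g \<in> carrier G"
  shows "inv g \<otimes> y \<otimes> g \<in> conjugacy_class G x"
proof -
  obtain h where "h \<in> carrier G" "y = inv h \<otimes> x \<otimes> h"
    using assms by (auto simp: conjugacy_class_def)
  then show ?thesis
    using conj_mult[of x h g, symmetric] m_closed[of h g] assms
    unfolding conjugacy_class_def by blast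
qed

lemma conjugacy_class_self: "x \<in> carrier G \<Longrightarrow> x \<in> conjugacy_class G x"
  using conj_one[of x, symmetric] unfolding conjugacy_class_def by blast

lemma conjugacy_class_eq:
  assumes "x \<in> carrier G" "g \<in> carrier G"
  shows "conjugacy_class G (inv g \<otimes> x \<otimes> g) = conjugacy_class G x" (is "conjugacy_class G ?y = _")
proof -
  have y: "?y \<in> carrier G" "?y \<in> conjugacy_class G x"
    using assms by (auto simp: conjugacy_class_def)
  have "inv (inv g) \<otimes> ?y \<otimes> inv g = x"
    using conj_mult[OF assms(1,2) inv_closed[OF assms(2)]] conj_one[OF assms(1)] assms by simp
  then have x: "x \<in> conjugacy_class G ?y"
    using inv_closed[OF assms(2)] unfolding conjugacy_class_def mem_Collect_eq by metis
  have "conjugacy_class G a \<subseteq> conjugacy_class G b" if "a \<in> conjugacy_class G b" "b \<in> carrier G" for a b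
    using that conjugacy_class_conj[of b a] by (auto simp: conjugacy_class_def[of G a])
  with x y assms show ?thesis by blast
qed

lemma comm_rel_conj:
  assumes x: "x \<in> carrier G" and g: "g \<in> carrier G"
    and yz: "(y, z) \<in> (comm_rel G (conjugacy_class G x))\<^sup>*"
  shows "(inv g \<otimes> y \<otimes> g, inv g \<otimes> z \<otimes> g) \<in> (comm_rel G (conjugacy_class G x))\<^sup>*"
  using yz
proof induction
  case (step a b)
  from step(2) have ab: "a \<in> conjugacy_class G x" "b \<in> conjugacy_class G x" "a \<otimes> b = b \<otimes> a"
    by (auto simp: comm_rel_def)
  then have "a \<in> carrier G" "b \<in> carrier G"
    using conjugacy_class_carrier x by auto
  then have "(inv g \<otimes> a \<otimes> g, inv g \<otimes> b \<otimes> g) \<in> comm_rel G (conjugacy_class G x)"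
    using ab conjugacy_class_conj[OF x _ g] g by (simp add: comm_rel_def conj_hom[symmetric])
  with step(3) show ?case by (rule rtrancl_into_rtrancl)
qed simp

text \<open>Paths are transported by conjugation. A path from x to x^g, conjugated by the inverse of
  g, ends at x; conjugated by h, it prolongs the path from x to x^h up to x^(gh).\<close>

lemma subgroup_reach_stab:
  assumes x: "x \<in> carrier G"
  shows "subgroup (reach_stab G x) G"
proof (rule subgroupI)
  show "reach_stab G x \<subseteq> carrier G" by (auto simp: reach_stab_def)
  show "reach_stab G x \<noteq> {}"
    using conj_one[OF x] by (auto simp: reach_stab_def intro!: exI[of _ \<one>])
next
  fix g assume "g \<in> reach_stab G x"
  then have g: "g \<in> carrier G"
    and r: "(x, inv g \<otimes> x \<otimes> g) \<in> (comm_rel G (conjugacy_class G x))\<^sup>*"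
    by (auto simp: reach_stab_def)
  have "inv (inv g) \<otimes> (inv g \<otimes> x \<otimes> g) \<otimes> inv g = x"
    using conj_mult[OF x g inv_closed[OF g]] conj_one[OF x] g by simp
  with comm_rel_conj[OF x inv_closed[OF g] r]
  have "(inv (inv g) \<otimes> x \<otimes> inv g, x) \<in> (comm_rel G (conjugacy_class G x))\<^sup>*"
    by simp
  then show "inv g \<in> reach_stab G x"
    using g sym_rtrancl[OF sym_comm_rel[of G "conjugacy_class G x"]]
    by (auto simp: reach_stab_def dest: symD)
next
  fix g h assume "g \<in> reach_stab G x" "h \<in> reach_stab G x"
  then have g: "g \<in> carrier G"
    and r: "(x, inv g \<otimes> x \<otimes> g) \<in> (comm_rel G (conjugacy_class G x))\<^sup>*"
    and h: "h \<in> carrier G"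
    and s: "(x, inv h \<otimes> x \<otimes> h) \<in> (comm_rel G (conjugacy_class G x))\<^sup>*"
    by (auto simp: reach_stab_def)
  from rtrancl_trans[OF s comm_rel_conj[OF x h r]] g h x
  show "g \<otimes> h \<in> reach_stab G x"
    by (simp add: reach_stab_def conj_mult)
qed

lemma connected_commuting_graph_iff_reach_stab:
  assumes x: "x \<in> carrier G"
  shows "connected (with_proj (commuting_graph G (conjugacy_class G x))) \<longleftrightarrow>
    carrier G \<subseteq> reach_stab G x"
proof
  assume "connected (with_proj (commuting_graph G (conjugacy_class G x)))"
  then show "carrier G \<subseteq> reach_stab G x"
    using conjugacy_class_self[OF x] conjugacy_class_conj[OF x conjugacy_class_self[OF x]]
    by (auto simp: connected_commuting_graph reach_stab_def)
next
  assume H: "carrier G \<subseteq> reach_stab G x"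
  have *: "(x, y) \<in> (comm_rel G (conjugacy_class G x))\<^sup>*" if "y \<in> conjugacy_class G x" for y
    using that H by (auto simp: conjugacy_class_def[of G x] reach_stab_def)
  have "(y, z) \<in> (comm_rel G (conjugacy_class G x))\<^sup>*"
    if "y \<in> conjugacy_class G x" "z \<in> conjugacy_class G x" for y z
    using *[OF that(1)] *[OF that(2)] sym_rtrancl[OF sym_comm_rel[of G "conjugacy_class G x"]]
    by (meson rtrancl_trans symD)
  then show "connected (with_proj (commuting_graph G (conjugacy_class G x)))"
    using conjugacy_class_self[OF x] by (auto simp: connected_commuting_graph)
qed

text \<open>A path of at most one edge. The choice y = x is allowed, so the centraliser of x is
  covered too.\<close>

lemma reach_stab_commI:
  assumes "x \<in> carrier G" "g \<in> carrier G" "y \<in> carrier G" "g \<otimes> y = x \<otimes> g" "x \<otimes> y = y \<otimes> x"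
  shows "g \<in> reach_stab G x"
proof -
  have y: "inv g \<otimes> x \<otimes> g = y" using assms by (simp add: conj_eq_iff)
  then have "y \<in> conjugacy_class G x"
    using assms(1,2) conjugacy_class_conj conjugacy_class_self by blast
  then show ?thesis
    using y assms conjugacy_class_self[OF assms(1)]
    by (auto simp: reach_stab_def comm_rel_def)
qed

text \<open>Prolongs a known path by one edge, for a conjugate y that need not commute with x but
  commutes with a conjugate z already reached.\<close>

lemma reach_stab_comm2I:
  assumes "x \<in> carrier G" "g \<in> carrier G" "y \<in> carrier G" "g \<otimes> y = x \<otimes> g"
    and "h \<in> reach_stab G x" "z \<in> carrier G" "h \<otimes> z = x \<otimes> h" "z \<otimes> y = y \<otimes> z"
  shows "g \<in> reach_stab G x"
proof -
  have h: "h \<in> carrier G" using assms by (auto simp: reach_stab_def)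
  have yz: "inv g \<otimes> x \<otimes> g = y" "inv h \<otimes> x \<otimes> h = z" using assms h by (simp_all add: conj_eq_iff)
  then have "y \<in> conjugacy_class G x" "z \<in> conjugacy_class G x"
    using assms(1,2) h conjugacy_class_conj conjugacy_class_self by blast+
  then have "(z, y) \<in> comm_rel G (conjugacy_class G x)"
    using assms by (auto simp: comm_rel_def)
  with assms(5) yz show ?thesis
    using assms(2) by (auto simp: reach_stab_def intro: rtrancl_into_rtrancl)
qed

text \<open>A function constant along edges is constant on components; each disconnected case
  supplies such an f and a conjugator g that changes its value.\<close>

lemma not_connected_commuting_graphI:
  assumes "x \<in> carrier G" "g \<in> carrier G" "f (inv g \<otimes> x \<otimes> g) \<noteq> f x"
    and inv: "\<And>y z. y \<in> conjugacy_class G x \<Longrightarrow> z \<in> conjugacy_class G x \<Longrightarrow> y \<otimes> z = z \<otimes> y \<Longrightarrow> f y = f z"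
  shows "\<not> connected (with_proj (commuting_graph G (conjugacy_class G x)))"
proof
  assume "connected (with_proj (commuting_graph G (conjugacy_class G x)))"
  then have "(x, inv g \<otimes> x \<otimes> g) \<in> (comm_rel G (conjugacy_class G x))\<^sup>*"
    using assms(1,2) connected_commuting_graph_iff_reach_stab by (auto simp: reach_stab_def)
  then have "f (inv g \<otimes> x \<otimes> g) = f x"
  proof induction
    case (step y z)
    then show ?case using inv[of y z] by (simp add: comm_rel_def)
  qed simp
  with assms(3) show False by simp
qed

end

section \<open>Generators of the affine group\<close>

text \<open>The component of v along the vector with label k, where -k labels the opposite vector.
  In these terms a signed permutation acts on vectors by mere relabelling, without signs.\<close>

definition odd_ext :: "(int \<Rightarrow> int) \<Rightarrow> int \<Rightarrow> int" where
  "odd_ext v k = sgn k * v \<bar>k\<bar>"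

lemma odd_ext_simps [simp]:
  "odd_ext v (- k) = - odd_ext v k" "odd_ext v 0 = 0" "odd_ext (\<lambda>i. 0) k = 0"
  "odd_ext (\<lambda>i. u i + w i) k = odd_ext u k + odd_ext w k"
  by (auto simp: odd_ext_def sgn_minus algebra_simps)

lemma odd_ext_pos: "k > 0 \<Longrightarrow> odd_ext v k = v k"
  by (simp add: odd_ext_def)

lemma signed_perms_zero: "\<sigma> \<in> signed_perms n \<Longrightarrow> \<sigma> 0 = 0"
  using signed_perms_neg[of \<sigma> n 0] by simp

lemma signed_perms_outside: "\<sigma> \<in> signed_perms n \<Longrightarrow> int n < \<bar>k\<bar> \<Longrightarrow> \<sigma> k = k"
  by (auto simp: signed_perms_def permutes_def)

lemma int_vectors_outside: "v \<in> int_vectors n \<Longrightarrow> int n < k \<Longrightarrow> v k = 0"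
  by (simp add: int_vectors_def)

lemma signed_perms_eqI:
  assumes "\<sigma> \<in> signed_perms n" "\<tau> \<in> signed_perms n" "\<And>k. k \<in> {1..int n} \<Longrightarrow> \<sigma> k = \<tau> k"
  shows "\<sigma> = \<tau>"
proof
  fix k
  consider "k = 0" | "int n < \<bar>k\<bar>" | "k \<in> {1..int n}" | "- k \<in> {1..int n}"
    by fastforce
  then show "\<sigma> k = \<tau> k"
  proof cases
    case 4
    with assms(3)[OF 4] show ?thesis
      using signed_perms_neg[OF assms(1), of k] signed_perms_neg[OF assms(2), of k] by simp
  qed (use assms in \<open>auto simp: signed_perms_zero signed_perms_outside\<close>)
qed

lemma signed_perms_abs_surj:
  assumes "\<rho> \<in> signed_perms n" "j \<in> {1..int n}"
  obtains k where "k \<in> {1..int n}" "\<bar>\<rho> k\<bar> = j"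
proof -
  have "(\<lambda>i. \<bar>\<rho> i\<bar>) ` {1..int n} = {1..int n}"
    using signed_perms_abs_inj[OF assms(1)] signed_perms_abs_range(1)[OF assms(1)]
    by (intro endo_inj_surj) blast+
  with assms(2) that show ?thesis by (metis (no_types, lifting) imageE)
qed

text \<open>The labels \<open>\<rho> k\<close> meet every coordinate up to sign. The detour through
  \<open>\<rho>\<close> suits products, whose shift is known at the labels
  \<open>\<tau> (\<alpha> k)\<close>.\<close>

lemma int_vectors_eqI:
  assumes "u \<in> int_vectors n" "v \<in> int_vectors n" "\<rho> \<in> signed_perms n"
    and "\<And>k. k \<in> {1..int n} \<Longrightarrow> odd_ext u (\<rho> k) = odd_ext v (\<rho> k)"
  shows "u = v"
proof
  fix j
  show "u j = v j"
  proof (cases "j \<in> {1..int n}")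
    case True
    then obtain k where k: "k \<in> {1..int n}" "\<bar>\<rho> k\<bar> = j"
      using signed_perms_abs_surj[OF assms(3)] by blast
    with assms(4)[OF k(1)] signed_perms_abs_range(2)[OF assms(3) k(1)] show ?thesis
      by (auto simp: odd_ext_def sgn_eq_0_iff)
  next
    case False
    with assms(1,2) show ?thesis by (simp add: int_vectors_def)
  qed
qed

lemma signed_perms_involI:
  assumes "\<And>k. \<sigma> (- k) = - \<sigma> k" "\<And>k. int n < \<bar>k\<bar> \<Longrightarrow> \<sigma> k = k" "\<And>k. \<sigma> (\<sigma> k) = k"
  shows "\<sigma> \<in> signed_perms n"
proof -
  have "\<sigma> 0 = 0" using assms(1)[of 0] by simp
  moreover have "\<exists>!x. \<sigma> x = y" for y using assms(3) by metis
  ultimately show ?thesis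
    using assms(1,2) by (auto simp: signed_perms_def permutes_def not_le)
qed

lemma odd_ext_vec_act:
  assumes s: "\<sigma> \<in> signed_perms n" and v: "v \<in> int_vectors n"
  shows "odd_ext (vec_act n \<sigma> v) (\<sigma> k) = odd_ext v k"
proof -
  have pos: "odd_ext (vec_act n \<sigma> v) (\<sigma> k) = odd_ext v k" if k: "k \<in> {1..int n}" for k
    using vec_act_at[OF s k, of v] signed_perms_abs_range(2)[OF s k] k
    by (simp add: odd_ext_def mult.assoc[symmetric] sgn_mult_self_eq)
  consider "k = 0" | "int n < \<bar>k\<bar>" | "k \<in> {1..int n}" | "- k \<in> {1..int n}"
    by fastforce
  then show ?thesis
  proof cases
    case 1
    then show ?thesis by (simp add: signed_perms_zero[OF s])
  next
    case 2
    then show ?thesis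
      using v vec_act_in[OF s, of v] signed_perms_outside[OF s 2]
      by (simp add: odd_ext_def int_vectors_outside)
  next
    case 4
    then show ?thesis using pos[OF 4] signed_perms_neg[OF s, of k] by simp
  qed (use pos in auto)
qed

lemma affine_C_mult:
  "(\<alpha>, v) \<otimes>\<^bsub>affine_C n\<^esub> (\<tau>, u) = (\<tau> \<circ> \<alpha>, \<lambda>i. vec_act n \<tau> v i + u i)"
  by (simp add: affine_C_def)

lemma affine_C_carrier: "(\<sigma>, v) \<in> carrier (affine_C n) \<longleftrightarrow> \<sigma> \<in> signed_perms n \<and> v \<in> int_vectors n"
  by (simp add: affine_C_def)

text \<open>
  The product of \<open>(\<alpha>, v)\<close> and \<open>(\<tau>, u)\<close> maps a label \<open>k\<close> to \<open>\<tau> (\<alpha> k)\<close> and shifts the coordinate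
  there by \<open>odd_ext v (\<alpha> k) + odd_ext u (\<tau> (\<alpha> k))\<close>.
\<close>

lemma affine_C_mult_eq_iff:
  assumes "(\<alpha>, v) \<in> carrier (affine_C n)" "(\<tau>, u) \<in> carrier (affine_C n)"
    and "(\<alpha>', v') \<in> carrier (affine_C n)" "(\<tau>', u') \<in> carrier (affine_C n)"
  shows "(\<alpha>, v) \<otimes>\<^bsub>affine_C n\<^esub> (\<tau>, u) = (\<alpha>', v') \<otimes>\<^bsub>affine_C n\<^esub> (\<tau>', u') \<longleftrightarrow>
    (\<forall>k\<in>{1..int n}. \<tau> (\<alpha> k) = \<tau>' (\<alpha>' k) \<and>
      odd_ext v (\<alpha> k) + odd_ext u (\<tau> (\<alpha> k)) = odd_ext v' (\<alpha>' k) + odd_ext u' (\<tau>' (\<alpha>' k)))"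
    (is "?L \<longleftrightarrow> ?R")
proof -
  let ?w = "\<lambda>i. vec_act n \<tau> v i + u i" and ?w' = "\<lambda>i. vec_act n \<tau>' v' i + u' i"
  have c: "\<alpha> \<in> signed_perms n" "\<tau> \<in> signed_perms n" "\<alpha>' \<in> signed_perms n" "\<tau>' \<in> signed_perms n"
    "v \<in> int_vectors n" "u \<in> int_vectors n" "v' \<in> int_vectors n" "u' \<in> int_vectors n"
    using assms by (auto simp: affine_C_carrier)
  have w: "odd_ext ?w (\<tau> (\<alpha> k)) = odd_ext v (\<alpha> k) + odd_ext u (\<tau> (\<alpha> k))"
    "odd_ext ?w' (\<tau>' (\<alpha>' k)) = odd_ext v' (\<alpha>' k) + odd_ext u' (\<tau>' (\<alpha>' k))" for k
    using c by (simp_all add: odd_ext_vec_act)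
  show ?thesis
  proof
    assume ?L
    then have p: "\<tau> \<circ> \<alpha> = \<tau>' \<circ> \<alpha>'" and v: "?w = ?w'" by (auto simp: affine_C_mult)
    show ?R
      using w p v by (metis comp_apply)
  next
    assume R: ?R
    have p: "\<tau> \<circ> \<alpha> = \<tau>' \<circ> \<alpha>'"
      using c R by (intro signed_perms_eqI[of _ n] signed_perms_comp) auto
    have "?w = ?w'"
    proof (rule int_vectors_eqI[where \<rho> = "\<tau> \<circ> \<alpha>"])
      fix k assume k: "k \<in> {1..int n}"
      then have "\<tau> (\<alpha> k) = \<tau>' (\<alpha>' k)" using R by blast
      then show "odd_ext ?w ((\<tau> \<circ> \<alpha>) k) = odd_ext ?w' ((\<tau> \<circ> \<alpha>) k)"
        using R k w[of k] by (metis comp_apply)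
    qed (use c in \<open>auto intro: signed_perms_comp int_vectors_add vec_act_in\<close>)
    with p show ?L by (simp add: affine_C_mult)
  qed
qed

definition perm_elem :: "(int \<Rightarrow> int) \<Rightarrow> (int \<Rightarrow> int) \<times> (int \<Rightarrow> int)" where
  "perm_elem \<pi> = (\<lambda>k. sgn k * \<pi> \<bar>k\<bar>, \<lambda>i. 0)"

definition flip_elem :: "int \<Rightarrow> (int \<Rightarrow> int) \<times> (int \<Rightarrow> int)" where
  "flip_elem i = (\<lambda>k. if \<bar>k\<bar> = i then - k else k, \<lambda>j. 0)"

definition shift_elem :: "int \<Rightarrow> (int \<Rightarrow> int) \<times> (int \<Rightarrow> int)" where
  "shift_elem i = (id, \<lambda>j. if j = i then 1 else 0)"

lemma zero_int_vectors: "(\<lambda>i. 0) \<in> int_vectors n"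
  by (simp add: int_vectors_def)

lemma perm_elem_carrier:
  assumes p: "\<pi> permutes {1..int n}" and i: "\<And>k. \<pi> (\<pi> k) = k"
  shows "perm_elem \<pi> \<in> carrier (affine_C n)"
proof -
  have pos: "0 < \<pi> k" if "0 < k" for k
  proof (cases "k \<in> {1..int n}")
    case True
    then have "\<pi> k \<in> {1..int n}" using permutes_in_image[OF p] by blast
    then show ?thesis by simp
  next
    case False
    then show ?thesis using p that by (auto simp: permutes_def)
  qed
  have "(\<lambda>k. sgn k * \<pi> \<bar>k\<bar>) \<in> signed_perms n"
  proof (rule signed_perms_involI)
    fix k :: int
    show "sgn (- k) * \<pi> \<bar>- k\<bar> = - (sgn k * \<pi> \<bar>k\<bar>)" by (simp add: sgn_minus)
    show "sgn k * \<pi> \<bar>k\<bar> = k" if "int n < \<bar>k\<bar>"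
      using that p by (auto simp: permutes_def sgn_if)
    show "sgn (sgn k * \<pi> \<bar>k\<bar>) * \<pi> \<bar>sgn k * \<pi> \<bar>k\<bar>\<bar> = k"
    proof (cases "k = 0")
      case False
      then have "0 < \<pi> \<bar>k\<bar>" using pos by simp
      with False i[of "\<bar>k\<bar>"] show ?thesis
        by (auto simp: sgn_mult abs_mult sgn_if)
    qed simp
  qed
  then show ?thesis by (simp add: perm_elem_def affine_C_carrier zero_int_vectors)
qed

lemma flip_signed_perms: "i \<in> {1..int n} \<Longrightarrow> (\<lambda>k. if \<bar>k\<bar> = i then - k else k) \<in> signed_perms n"
  by (rule signed_perms_involI) auto

lemma flip_elem_carrier: "i \<in> {1..int n} \<Longrightarrow> flip_elem i \<in> carrier (affine_C n)"
  by (simp add: flip_elem_def affine_C_carrier zero_int_vectors flip_signed_perms)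

lemma shift_elem_carrier: "i \<in> {1..int n} \<Longrightarrow> shift_elem i \<in> carrier (affine_C n)"
  by (auto simp: shift_elem_def affine_C_carrier id_signed_perms int_vectors_def)

lemma transpose_elem_carrier:
  "i \<in> {1..int n} \<Longrightarrow> j \<in> {1..int n} \<Longrightarrow> perm_elem (transpose i j) \<in> carrier (affine_C n)"
  by (intro perm_elem_carrier permutes_swap_id) auto

lemma vec_act_zero: "vec_act n \<sigma> (\<lambda>i. 0) = (\<lambda>i. 0)"
  by (simp add: vec_act_def)

lemma perm_mult: "(\<alpha>, \<lambda>i. 0) \<otimes>\<^bsub>affine_C n\<^esub> (\<tau>, u) = (\<tau> \<circ> \<alpha>, u)"
  by (simp add: affine_C_mult vec_act_zero)

lemma shift_mult:
  "u \<in> int_vectors n \<Longrightarrow> (id, u) \<otimes>\<^bsub>affine_C n\<^esub> (id, w) = (id, \<lambda>i. u i + w i)"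
  by (simp add: affine_C_mult vec_act_id)

text \<open>Each step moves one nonzero coordinate a unit towards 0, so the sum of the absolute
  values drops.\<close>

lemma translations_in_subgroup:
  assumes H: "subgroup H (affine_C n)" and s: "\<And>i. i \<in> {1..int n} \<Longrightarrow> shift_elem i \<in> H"
    and v: "v \<in> int_vectors n"
  shows "(id, v) \<in> H"
  using v
proof (induction "\<Sum>i\<in>{1..int n}. nat \<bar>v i\<bar>" arbitrary: v rule: less_induct)
  case less
  interpret group "affine_C n" by (rule group_affine_C)
  show ?case
  proof (cases "\<exists>i\<in>{1..int n}. v i \<noteq> 0")
    case False
    then have "v = (\<lambda>i. 0)" using less.prems unfolding int_vectors_def by blast
    then have "(id, v) = \<one>\<^bsub>affine_C n\<^esub>" by (simp add: affine_C_def)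
    then show ?thesis using subgroup.one_closed[OF H] by simp
  next
    case True
    then obtain i where i: "i \<in> {1..int n}" "v i \<noteq> 0" by blast
    define w where "w = v(i := v i - sgn (v i))"
    define e where "e = (\<lambda>j. if j = i then sgn (v i) else 0)"
    have w: "w \<in> int_vectors n" and e: "e \<in> int_vectors n"
      using less.prems i by (auto simp: int_vectors_def w_def e_def)
    have "(\<Sum>j\<in>{1..int n}. nat \<bar>w j\<bar>) < (\<Sum>j\<in>{1..int n}. nat \<bar>v j\<bar>)"
      using i by (intro sum_strict_mono_ex1) (auto simp: w_def sgn_if)
    from less.hyps[OF this w] have "(id, w) \<in> H" .
    moreover have "(id, e) \<in> H"
    proof (cases "v i > 0")
      case True
      then have "(id, e) = shift_elem i" by (auto simp: e_def shift_elem_def)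
      with s[OF i(1)] show ?thesis by simp
    next
      case False
      let ?d = "(\<lambda>j. if j = i then 1 else 0) :: int \<Rightarrow> int"
      have "shift_elem i \<otimes>\<^bsub>affine_C n\<^esub> (id, e) = (id, \<lambda>j. ?d j + e j)"
        using i(1) unfolding shift_elem_def by (intro shift_mult) (auto simp: int_vectors_def)
      also have "(\<lambda>j. ?d j + e j) = (\<lambda>j. 0)"
        using False i(2) by (auto simp: e_def)
      also have "(id, \<lambda>j. 0) = \<one>\<^bsub>affine_C n\<^esub>"
        by (simp add: affine_C_def)
      finally have "shift_elem i \<otimes>\<^bsub>affine_C n\<^esub> (id, e) = \<one>\<^bsub>affine_C n\<^esub>" .
      then have "(id, e) = inv\<^bsub>affine_C n\<^esub> shift_elem i"
        using e shift_elem_carrier[OF i(1)]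
        by (intro inv_equality[OF inv_comm, symmetric])
          (auto simp: affine_C_carrier id_signed_perms)
      with subgroup.m_inv_closed[OF H s[OF i(1)]] show ?thesis by simp
    qed
    ultimately have "(id, w) \<otimes>\<^bsub>affine_C n\<^esub> (id, e) \<in> H" by (rule subgroup.m_closed[OF H])
    moreover have "(\<lambda>j. w j + e j) = v" by (auto simp: w_def e_def)
    ultimately show ?thesis using w by (simp add: shift_mult)
  qed
qed

text \<open>Induction on the number of positive labels that \<sigma> does not fix: following
  \<sigma> by an element of H that takes \<open>\<sigma> i\<close> back to i and respects all fixed
  labels fixes one label more.\<close>

lemma signed_perms_in_subgroup:
  assumes H: "subgroup H (affine_C n)"
    and t: "\<And>i j. i \<in> {1..int n} \<Longrightarrow> j \<in> {1..int n} \<Longrightarrow> perm_elem (transpose i j) \<in> H"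
    and f: "\<And>i. i \<in> {1..int n} \<Longrightarrow> flip_elem i \<in> H"
    and "\<sigma> \<in> signed_perms n"
  shows "(\<sigma>, \<lambda>i. 0) \<in> H"
  using assms(4)
proof (induction "card {i \<in> {1..int n}. \<sigma> i \<noteq> i}" arbitrary: \<sigma> rule: less_induct)
  case (less \<sigma>)
  interpret group "affine_C n" by (rule group_affine_C)
  have step: "(\<sigma>, \<lambda>i. 0) \<in> H"
    if i: "i \<in> {1..int n}" "\<sigma> i \<noteq> i" and w: "(\<omega>, \<lambda>i. 0) \<in> H" "\<omega> (\<sigma> i) = i"
      "\<And>k. k \<in> {1..int n} \<Longrightarrow> \<sigma> k = k \<Longrightarrow> \<omega> k = k" for i \<omega>
  proof -
    have ws: "\<omega> \<in> signed_perms n"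
      using subgroup.mem_carrier[OF H w(1)] by (simp add: affine_C_carrier)
    have c: "(\<sigma>, \<lambda>i. 0) \<in> carrier (affine_C n)"
      using less.prems by (simp add: affine_C_carrier zero_int_vectors)
    have "card {k \<in> {1..int n}. (\<omega> \<circ> \<sigma>) k \<noteq> k} < card {k \<in> {1..int n}. \<sigma> k \<noteq> k}"
    proof (rule psubset_card_mono)
      show "finite {k \<in> {1..int n}. \<sigma> k \<noteq> k}"
        by (rule finite_subset[of _ "{1..int n}"]) auto
    qed (use i w in auto)
    from less.hyps[OF this signed_perms_comp[OF less.prems ws]]
    have "(\<sigma>, \<lambda>i. 0) \<otimes>\<^bsub>affine_C n\<^esub> (\<omega>, \<lambda>i. 0) \<in> H" by (simp add: perm_mult)
    then have "(\<sigma>, \<lambda>i. 0) \<otimes>\<^bsub>affine_C n\<^esub> (\<omega>, \<lambda>i. 0) \<otimes>\<^bsub>affine_C n\<^esub> inv\<^bsub>affine_C n\<^esub> (\<omega>, \<lambda>i. 0) \<in> H"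
      using w(1) subgroup.m_closed[OF H] subgroup.m_inv_closed[OF H] by blast
    then show ?thesis
      using c subgroup.mem_carrier[OF H w(1)] by (simp add: m_assoc)
  qed
  show ?case
  proof (cases "\<exists>i\<in>{1..int n}. \<sigma> i \<noteq> i")
    case False
    then have "\<sigma> = id"
      using less.prems by (intro signed_perms_eqI[OF _ id_signed_perms]) auto
    then have "(\<sigma>, \<lambda>i. 0) = \<one>\<^bsub>affine_C n\<^esub>" by (simp add: affine_C_def)
    then show ?thesis using subgroup.one_closed[OF H] by simp
  next
    case True
    then obtain i where i: "i \<in> {1..int n}" "\<sigma> i \<noteq> i" by blast
    define j where "j = \<bar>\<sigma> i\<bar>"
    have j: "j \<in> {1..int n}" "\<sigma> i \<noteq> 0"
      using signed_perms_abs_range[OF less.prems i(1)] by (auto simp: j_def)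
    \<comment> \<open>If j were fixed, i and j would have the same image up to sign. Hence
      exchanging i and j disturbs no fixed label.\<close>
    have nj: "\<sigma> j \<noteq> j" if "j \<noteq> i"
    proof
      assume "\<sigma> j = j"
      then have "\<bar>\<sigma> j\<bar> = \<bar>\<sigma> i\<bar>" using j by (simp add: j_def)
      then show False
        using inj_onD[OF signed_perms_abs_inj[OF less.prems], of j i] i j that by simp
    qed
    let ?F = "\<lambda>k. if \<bar>k\<bar> = i then - k else k" and ?T = "\<lambda>k. sgn k * transpose i j \<bar>k\<bar>"
    have F: "(?F, \<lambda>i. 0) \<in> H" and T: "(?T, \<lambda>i. 0) \<in> H"
      using f[OF i(1)] t[OF i(1) j(1)] by (simp_all add: flip_elem_def perm_elem_def)
    have FT: "(?F \<circ> ?T, \<lambda>i. 0) \<in> H"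
      using subgroup.m_closed[OF H T F] by (simp add: perm_mult)
    have fixed: "k \<noteq> i" "k \<noteq> j" if "\<sigma> k = k" for k
      using that i(2) nj by metis+
    have "\<sigma> i = j \<or> \<sigma> i = - j" unfolding j_def by linarith
    then consider "\<sigma> i = - j" "j = i" | "\<sigma> i = j" | "\<sigma> i = - j" "j \<noteq> i" by blast
    then show ?thesis
    proof cases
      case 1
      show ?thesis
      proof (rule step[OF i F])
        show "?F (\<sigma> i) = i" using 1 i(1) by simp
        show "?F k = k" if "k \<in> {1..int n}" "\<sigma> k = k" for k
          using that fixed[OF that(2)] by simp
      qed
    next
      case 2
      show ?thesis
      proof (rule step[OF i T])
        show "?T (\<sigma> i) = i" using 2 i(1) j(1) by simp
        show "?T k = k" if "k \<in> {1..int n}" "\<sigma> k = k" for k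
          using that fixed[OF that(2)] by (simp add: transpose_apply_other)
      qed
    next
      case 3
      show ?thesis
      proof (rule step[OF i FT])
        show "(?F \<circ> ?T) (\<sigma> i) = i" using 3 i(1) j(1) by simp
        show "(?F \<circ> ?T) k = k" if "k \<in> {1..int n}" "\<sigma> k = k" for k
          using that fixed[OF that(2)] by (simp add: transpose_apply_other)
      qed
    qed
  qed
qed

lemma (in group) subgroup_conjI:
  assumes "subgroup H G" "t \<in> H" "h \<in> H" "y \<in> carrier G" "t \<otimes> y = h \<otimes> t"
  shows "y \<in> H"
proof -
  have "inv t \<otimes> h \<otimes> t = y"
    using assms by (subst conj_eq_iff) (auto dest: subgroup.mem_carrier)
  then show ?thesis
    using assms by (metis subgroup.m_closed subgroup.m_inv_closed)
qed

text \<open>Transpositions conjugate the flip and the shift at a to every other coordinate, and each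
  element is a signed permutation followed by a translation.\<close>

lemma affine_C_generated:
  assumes H: "subgroup H (affine_C n)"
    and t: "\<And>i j. i \<in> {1..int n} \<Longrightarrow> j \<in> {1..int n} \<Longrightarrow> perm_elem (transpose i j) \<in> H"
    and a: "a \<in> {1..int n}" and f: "flip_elem a \<in> H" and s: "shift_elem a \<in> H"
  shows "carrier (affine_C n) \<subseteq> H"
proof
  interpret group "affine_C n" by (rule group_affine_C)
  have F: "flip_elem i \<in> H" if i: "i \<in> {1..int n}" for i
  proof (rule subgroup_conjI[OF H t[OF a i] f flip_elem_carrier[OF i]])
    have "perm_elem (transpose a i) \<in> carrier (affine_C n)" by (rule transpose_elem_carrier[OF a i])
    then show "perm_elem (transpose a i) \<otimes>\<^bsub>affine_C n\<^esub> flip_elem i =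
        flip_elem a \<otimes>\<^bsub>affine_C n\<^esub> perm_elem (transpose a i)"
      using flip_elem_carrier[OF i] flip_elem_carrier[OF a] a i
      unfolding perm_elem_def flip_elem_def
      by (subst affine_C_mult_eq_iff) (auto simp: transpose_def)
  qed
  have S: "shift_elem i \<in> H" if i: "i \<in> {1..int n}" for i
  proof (rule subgroup_conjI[OF H t[OF a i] s shift_elem_carrier[OF i]])
    have "perm_elem (transpose a i) \<in> carrier (affine_C n)" by (rule transpose_elem_carrier[OF a i])
    then show "perm_elem (transpose a i) \<otimes>\<^bsub>affine_C n\<^esub> shift_elem i =
        shift_elem a \<otimes>\<^bsub>affine_C n\<^esub> perm_elem (transpose a i)"
      using shift_elem_carrier[OF i] shift_elem_carrier[OF a] a i
      unfolding perm_elem_def shift_elem_def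
      by (subst affine_C_mult_eq_iff) (auto simp: transpose_def odd_ext_def)
  qed
  fix g assume "g \<in> carrier (affine_C n)"
  then obtain \<sigma> v where g: "g = (\<sigma>, v)" "\<sigma> \<in> signed_perms n" "v \<in> int_vectors n"
    by (cases g) (auto simp: affine_C_carrier)
  have "(\<sigma>, \<lambda>i. 0) \<otimes>\<^bsub>affine_C n\<^esub> (id, v) \<in> H"
    using signed_perms_in_subgroup[OF H t F g(2)] translations_in_subgroup[OF H S g(3)]
    by (rule subgroup.m_closed[OF H])
  then show "g \<in> H" by (simp add: perm_mult g(1))
qed

section \<open>Involutions in normal form\<close>

text \<open>Phrased with projections so that simplification rules for \<open>fst\<close> and
  \<open>snd\<close> of named elements apply without unfolding these.\<close>

lemma affine_C_mult_eqI:
  assumes "a \<in> carrier (affine_C n)" "b \<in> carrier (affine_C n)"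
    and "c \<in> carrier (affine_C n)" "d \<in> carrier (affine_C n)"
    and "\<And>k. k \<in> {1..int n} \<Longrightarrow> fst b (fst a k) = fst d (fst c k) \<and>
      odd_ext (snd a) (fst a k) + odd_ext (snd b) (fst b (fst a k)) =
      odd_ext (snd c) (fst c k) + odd_ext (snd d) (fst d (fst c k))"
  shows "a \<otimes>\<^bsub>affine_C n\<^esub> b = c \<otimes>\<^bsub>affine_C n\<^esub> d"
proof (cases a; cases b; cases c; cases d)
  fix \<alpha> v \<tau> u \<alpha>' v' \<tau>' u'
  assume e: "a = (\<alpha>, v)" "b = (\<tau>, u)" "c = (\<alpha>', v')" "d = (\<tau>', u')"
  show ?thesis
    using assms(5) unfolding e affine_C_mult_eq_iff[OF assms(1-4)[unfolded e]] fst_conv snd_conv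
    by blast
qed

lemma perm_elem_simps [simp]:
  "0 < k \<Longrightarrow> fst (perm_elem \<pi>) k = \<pi> k" "fst (perm_elem \<pi>) (- k) = - fst (perm_elem \<pi>) k"
  "snd (perm_elem \<pi>) = (\<lambda>i. 0)"
  by (simp_all add: perm_elem_def sgn_minus)

lemma shift_elem_simps [simp]:
  "fst (shift_elem a) k = k" "0 < k \<Longrightarrow> odd_ext (snd (shift_elem a)) k = (if k = a then 1 else 0)"
  by (simp_all add: shift_elem_def odd_ext_pos)

lemma perm_elem_id: "perm_elem id = \<one>\<^bsub>affine_C n\<^esub>"
proof -
  have "(\<lambda>k::int. sgn k * id \<bar>k\<bar>) = id" by (auto simp: sgn_mult_abs)
  then show ?thesis by (simp add: perm_elem_def affine_C_def)
qed

lemma signed_perms_involI_pos: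
  assumes odd: "\<And>k. \<sigma> (- k) = - \<sigma> k" and out: "\<And>k. int n < k \<Longrightarrow> \<sigma> k = k"
    and invol: "\<And>k. 0 < k \<Longrightarrow> \<sigma> (\<sigma> k) = k"
  shows "\<sigma> \<in> signed_perms n"
proof (rule signed_perms_involI)
  show "\<sigma> (- k) = - \<sigma> k" for k by (rule odd)
  fix k :: int
  show "\<sigma> k = k" if "int n < \<bar>k\<bar>"
    using that out[of k] out[of "- k"] odd[of k] by linarith
  show "\<sigma> (\<sigma> k) = k"
    using invol[of k] invol[of "- k"] odd[of 0] odd[of k] odd[of "\<sigma> k"]
    by (cases k "0::int" rule: linorder_cases) auto
qed

section \<open>Normal forms, their conjugates, and when they commute\<close>

definition normal_elem :: "(int \<Rightarrow> int) \<Rightarrow> int set \<Rightarrow> int set \<Rightarrow> (int \<Rightarrow> int) \<times> (int \<Rightarrow> int)" where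
  "normal_elem p R D = (\<lambda>k. if \<bar>k\<bar> \<in> R then - k else sgn k * p \<bar>k\<bar>, \<lambda>i. if i \<in> D then 1 else 0)"

lemma normal_elem_simps [simp]:
  "0 < k \<Longrightarrow> fst (normal_elem p R D) k = (if k \<in> R then - k else p k)"
  "fst (normal_elem p R D) (- k) = - fst (normal_elem p R D) k"
  "0 < k \<Longrightarrow> odd_ext (snd (normal_elem p R D)) k = (if k \<in> D then 1 else 0)"
  by (simp_all add: normal_elem_def sgn_minus odd_ext_def)

locale normal_data =
  fixes n :: nat and p :: "int \<Rightarrow> int" and R D :: "int set"
  assumes p_perm: "p permutes {1..int n}" and p_p [simp]: "p (p k) = k"
    and R_sub: "R \<subseteq> {1..int n}" and D_sub: "D \<subseteq> R" and p_R: "k \<in> R \<Longrightarrow> p k = k"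
begin

lemma p_in [simp]: "p k \<in> {1..int n} \<longleftrightarrow> k \<in> {1..int n}"
  by (rule permutes_in_image[OF p_perm])

lemma p_outside: "k \<notin> {1..int n} \<Longrightarrow> p k = k"
  using p_perm by (simp add: permutes_def)

lemma p_pos: "0 < k \<Longrightarrow> 0 < p k"
  using p_in[of k] p_outside[of k] by fastforce

lemma p_in_R [simp]: "p k \<in> R \<longleftrightarrow> k \<in> R"
  using p_R p_p by metis

lemma p_in_D [simp]: "p k \<in> D \<longleftrightarrow> k \<in> D"
  using p_R p_p D_sub by (metis subsetD)

lemma p_eq_iff [simp]: "p k = p l \<longleftrightarrow> k = l"
  using p_p by metis

lemma p_swap: "p k = l \<longleftrightarrow> k = p l"
  using p_p by metis

lemma normal_elem_carrier: "normal_elem p R D \<in> carrier (affine_C n)"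
proof -
  have "(\<lambda>k. if \<bar>k\<bar> \<in> R then - k else sgn k * p \<bar>k\<bar>) \<in> signed_perms n"
  proof (rule signed_perms_involI)
    fix k :: int
    show "(if \<bar>- k\<bar> \<in> R then - (- k) else sgn (- k) * p \<bar>- k\<bar>) =
        - (if \<bar>k\<bar> \<in> R then - k else sgn k * p \<bar>k\<bar>)"
      by (simp add: sgn_minus)
    show "(if \<bar>k\<bar> \<in> R then - k else sgn k * p \<bar>k\<bar>) = k" if "int n < \<bar>k\<bar>"
      using that R_sub p_outside[of "\<bar>k\<bar>"] by (auto simp: sgn_if)
    let ?s = "\<lambda>k. if \<bar>k\<bar> \<in> R then - k else sgn k * p \<bar>k\<bar>"
    show "?s (?s k) = k"
    proof (cases "k = 0")
      case False
      then have "0 < p \<bar>k\<bar>" by (simp add: p_pos)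
      with False show ?thesis
        by (auto simp: sgn_mult abs_mult sgn_if)
    qed (use R_sub in auto)
  qed
  then show ?thesis
    using D_sub R_sub by (auto simp: normal_elem_def affine_C_carrier int_vectors_def)
qed

end

lemma normal_data_conj:
  assumes "normal_data n p R D" "\<pi> permutes {1..int n}" "\<And>k. \<pi> (\<pi> k) = k"
  shows "normal_data n (\<pi> \<circ> p \<circ> \<pi>) {k. \<pi> k \<in> R} {k. \<pi> k \<in> D}"
proof -
  interpret normal_data n p R D by fact
  show ?thesis
  proof
    show "\<pi> \<circ> p \<circ> \<pi> permutes {1..int n}" using assms p_perm by (intro permutes_compose)
    show "{k. \<pi> k \<in> R} \<subseteq> {1..int n}"
      using R_sub permutes_in_image[OF assms(2)] by blast
  qed (use assms(3) D_sub p_R in auto)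
qed

text \<open>A coordinate permutation brings in no signs or shifts, so the conjugate is again in
  normal form. As \<open>\<pi>\<close> is its own inverse, R and D are transported by taking
  preimages under \<open>\<pi>\<close>.\<close>

lemma normal_elem_conj:
  assumes N: "normal_data n p R D" and \<pi>: "\<pi> permutes {1..int n}" "\<And>k. \<pi> (\<pi> k) = k"
  shows "perm_elem \<pi> \<otimes>\<^bsub>affine_C n\<^esub> normal_elem (\<pi> \<circ> p \<circ> \<pi>) {k. \<pi> k \<in> R} {k. \<pi> k \<in> D} =
    normal_elem p R D \<otimes>\<^bsub>affine_C n\<^esub> perm_elem \<pi>"
proof -
  interpret normal_data n p R D by fact
  interpret N': normal_data n "\<pi> \<circ> p \<circ> \<pi>" "{k. \<pi> k \<in> R}" "{k. \<pi> k \<in> D}"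
    by (rule normal_data_conj[OF assms])
  have pos: "0 < \<pi> k" if "k \<in> {1..int n}" for k
    using permutes_in_image[OF \<pi>(1), of k] that by simp
  show ?thesis
  proof (rule affine_C_mult_eqI)
    fix k assume k: "k \<in> {1..int n}"
    have "0 < k" "0 < \<pi> k" "0 < p k" "0 < \<pi> (p k)"
      using k pos[OF k] pos[OF p_in[THEN iffD2, OF k]] p_pos[of k] by simp_all
    then show "fst (normal_elem (\<pi> \<circ> p \<circ> \<pi>) {k. \<pi> k \<in> R} {k. \<pi> k \<in> D}) (fst (perm_elem \<pi>) k) =
        fst (perm_elem \<pi>) (fst (normal_elem p R D) k) \<and>
      odd_ext (snd (perm_elem \<pi>)) (fst (perm_elem \<pi>) k) +
        odd_ext (snd (normal_elem (\<pi> \<circ> p \<circ> \<pi>) {k. \<pi> k \<in> R} {k. \<pi> k \<in> D}))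
          (fst (normal_elem (\<pi> \<circ> p \<circ> \<pi>) {k. \<pi> k \<in> R} {k. \<pi> k \<in> D}) (fst (perm_elem \<pi>) k)) =
      odd_ext (snd (normal_elem p R D)) (fst (normal_elem p R D) k) +
        odd_ext (snd (perm_elem \<pi>)) (fst (perm_elem \<pi>) (fst (normal_elem p R D) k))"
      by (simp add: \<pi>(2))
  qed (fact normal_elem_carrier N'.normal_elem_carrier perm_elem_carrier[OF \<pi>])+
qed

text \<open>Each element has to respect the permutation of the other, its reflected coordinates and
  their centres. \<open>RD\<close> is the condition on a line reflected by both: reflections about 0
  and about 1/2 do not commute.\<close>

lemma normal_elem_commute:
  assumes N: "normal_data n p R D" and N': "normal_data n p' R' D'"
    and pp: "\<And>k. k \<in> {1..int n} \<Longrightarrow> p (p' k) = p' (p k)"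
    and R: "\<And>k. k \<in> {1..int n} \<Longrightarrow> p' k \<in> R \<longleftrightarrow> k \<in> R" "\<And>k. k \<in> {1..int n} \<Longrightarrow> p k \<in> R' \<longleftrightarrow> k \<in> R'"
    and D: "\<And>k. k \<in> {1..int n} \<Longrightarrow> p' k \<in> D \<longleftrightarrow> k \<in> D" "\<And>k. k \<in> {1..int n} \<Longrightarrow> p k \<in> D' \<longleftrightarrow> k \<in> D'"
    and RD: "\<And>k. k \<in> R \<Longrightarrow> k \<in> R' \<Longrightarrow> k \<in> D \<longleftrightarrow> k \<in> D'"
  shows "normal_elem p R D \<otimes>\<^bsub>affine_C n\<^esub> normal_elem p' R' D' =
    normal_elem p' R' D' \<otimes>\<^bsub>affine_C n\<^esub> normal_elem p R D"
proof -
  interpret normal_data n p R D by fact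
  interpret N': normal_data n p' R' D' by fact
  let ?x = "normal_elem p R D" and ?y = "normal_elem p' R' D'"
  show ?thesis
  proof (rule affine_C_mult_eqI)
    fix k assume k: "k \<in> {1..int n}"
    then have k': "p k \<in> {1..int n}" "p' k \<in> {1..int n}"
      by (simp_all del: atLeastAtMost_iff)
    have pos: "0 < k" "0 < p k" "0 < p' k" "0 < p (p' k)" "0 < p' (p k)"
      using k p_pos N'.p_pos by simp_all
    have n: "k \<in> D \<Longrightarrow> k \<in> R" "k \<in> D' \<Longrightarrow> k \<in> R'"
      using D_sub N'.D_sub by auto
    have s: "p' (p k) \<in> D \<longleftrightarrow> k \<in> D" "p (p' k) \<in> D' \<longleftrightarrow> k \<in> D'"
      using D(1)[OF k'(1)] D(2)[OF k'(2)] by simp_all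
    show "fst ?y (fst ?x k) = fst ?x (fst ?y k) \<and>
        odd_ext (snd ?x) (fst ?x k) + odd_ext (snd ?y) (fst ?y (fst ?x k)) =
        odd_ext (snd ?y) (fst ?y k) + odd_ext (snd ?x) (fst ?x (fst ?y k))"
      using pos n s R[OF k] D[OF k] pp[OF k] RD[of k] p_R[of k] N'.p_R[of k]
      by (cases "k \<in> R"; cases "k \<in> R'") auto
  qed (fact normal_elem_carrier N'.normal_elem_carrier)+
qed

section \<open>Coordinate exchanges that stay in the component\<close>

context normal_data
begin

abbreviation "x \<equiv> normal_elem p R D"
abbreviation "H \<equiv> reach_stab (affine_C n) (normal_elem p R D)"

sublocale grp: group "affine_C n" by (rule group_affine_C)

lemma H_subgroup: "subgroup H (affine_C n)"
  by (rule grp.subgroup_reach_stab[OF normal_elem_carrier])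

text \<open>Turns membership in H into combinatorics of p, R and D: the hypotheses are those of
  \<open>normal_elem_commute\<close> for x and its conjugate by \<open>\<pi>\<close>.\<close>

lemma perm_in_H:
  assumes \<pi>: "\<pi> permutes {1..int n}" "\<And>k. \<pi> (\<pi> k) = k"
    and "\<And>k. k \<in> {1..int n} \<Longrightarrow> p (\<pi> (p (\<pi> k))) = \<pi> (p (\<pi> (p k)))"
    and "\<And>k. k \<in> {1..int n} \<Longrightarrow> \<pi> (p (\<pi> k)) \<in> R \<longleftrightarrow> k \<in> R"
    and "\<And>k. k \<in> {1..int n} \<Longrightarrow> \<pi> (p k) \<in> R \<longleftrightarrow> \<pi> k \<in> R"
    and "\<And>k. k \<in> {1..int n} \<Longrightarrow> \<pi> (p (\<pi> k)) \<in> D \<longleftrightarrow> k \<in> D"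
    and "\<And>k. k \<in> {1..int n} \<Longrightarrow> \<pi> (p k) \<in> D \<longleftrightarrow> \<pi> k \<in> D"
    and "\<And>k. k \<in> R \<Longrightarrow> \<pi> k \<in> R \<Longrightarrow> k \<in> D \<longleftrightarrow> \<pi> k \<in> D"
  shows "perm_elem \<pi> \<in> H"
proof -
  note N = normal_data_axioms
  show ?thesis
  proof (rule grp.reach_stab_commI[OF normal_elem_carrier perm_elem_carrier[OF \<pi>]
        normal_data.normal_elem_carrier[OF normal_data_conj[OF N \<pi>]] normal_elem_conj[OF N \<pi>]])
    show "x \<otimes>\<^bsub>affine_C n\<^esub> normal_elem (\<pi> \<circ> p \<circ> \<pi>) {k. \<pi> k \<in> R} {k. \<pi> k \<in> D} =
        normal_elem (\<pi> \<circ> p \<circ> \<pi>) {k. \<pi> k \<in> R} {k. \<pi> k \<in> D} \<otimes>\<^bsub>affine_C n\<^esub> x"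
      by (rule normal_elem_commute[OF N normal_data_conj[OF N \<pi>]])
        (unfold comp_apply mem_Collect_eq, (fact assms(3-8))+)
  qed
qed

abbreviation rel :: "int \<Rightarrow> int \<Rightarrow> bool" (infix "\<approx>" 50) where
  "i \<approx> j \<equiv> perm_elem (transpose i j) \<in> H"

lemma rel_sym: "i \<approx> j \<Longrightarrow> j \<approx> i"
  by (simp add: transpose_commute)

lemma rel_perm:
  assumes \<pi>: "perm_elem \<pi> \<in> H" "\<pi> permutes {1..int n}" "\<And>k. \<pi> (\<pi> k) = k"
    and ij: "i \<in> {1..int n}" "j \<in> {1..int n}" "i \<approx> j"
  shows "\<pi> i \<approx> \<pi> j"
proof (rule grp.subgroup_conjI[OF H_subgroup \<pi>(1) ij(3)])
  have in_n: "\<pi> k \<in> {1..int n} \<longleftrightarrow> k \<in> {1..int n}" for k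
    by (rule permutes_in_image[OF \<pi>(2)])
  then show c: "perm_elem (transpose (\<pi> i) (\<pi> j)) \<in> carrier (affine_C n)"
    using ij by (intro transpose_elem_carrier) auto
  have pos: "0 < \<pi> k" if "k \<in> {1..int n}" for k using in_n[of k] that by simp
  have eq: "\<pi> k = \<pi> l \<longleftrightarrow> k = l" for k l using \<pi>(3) by metis
  show "perm_elem \<pi> \<otimes>\<^bsub>affine_C n\<^esub> perm_elem (transpose (\<pi> i) (\<pi> j)) =
      perm_elem (transpose i j) \<otimes>\<^bsub>affine_C n\<^esub> perm_elem \<pi>"
  proof (rule affine_C_mult_eqI)
    fix k assume k: "k \<in> {1..int n}"
    have "transpose (\<pi> i) (\<pi> j) (\<pi> k) = \<pi> (transpose i j k)"
      by (auto simp: transpose_def eq)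
    moreover have "0 < transpose i j k" using ij k by (auto simp: transpose_def)
    ultimately show "fst (perm_elem (transpose (\<pi> i) (\<pi> j))) (fst (perm_elem \<pi>) k) =
        fst (perm_elem \<pi>) (fst (perm_elem (transpose i j)) k) \<and>
      odd_ext (snd (perm_elem \<pi>)) (fst (perm_elem \<pi>) k) +
        odd_ext (snd (perm_elem (transpose (\<pi> i) (\<pi> j))))
          (fst (perm_elem (transpose (\<pi> i) (\<pi> j))) (fst (perm_elem \<pi>) k)) =
      odd_ext (snd (perm_elem (transpose i j))) (fst (perm_elem (transpose i j)) k) +
        odd_ext (snd (perm_elem \<pi>)) (fst (perm_elem \<pi>) (fst (perm_elem (transpose i j)) k))"
      using k pos[OF k] by simp
  qed (fact c perm_elem_carrier[OF \<pi>(2,3)] transpose_elem_carrier[OF ij(1,2)])+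
qed

lemma rel_trans:
  assumes "i \<in> {1..int n}" "j \<in> {1..int n}" "k \<in> {1..int n}" "i \<approx> j" "j \<approx> k"
  shows "i \<approx> k"
proof (cases "i = j \<or> i = k")
  case True
  have "i \<approx> i"
    using subgroup.one_closed[OF H_subgroup] perm_elem_id[of n] by (simp add: transpose_same)
  with True assms show ?thesis by auto
next
  case False
  \<comment> \<open>As i differs from j and k, this transposition takes the pair (i, j) to (i,
    k).\<close>
  have "transpose j k i \<approx> transpose j k j"
    using assms by (intro rel_perm[OF assms(5)]) (auto intro!: permutes_swap_id)
  with False show ?thesis by (simp add: transpose_def)
qed

text \<open>Conjugation merely exchanges what x does on the two lines, and the identity of a line
  commutes with everything there. Only reflections with different centres obstruct, so a fixed
  coordinate is related to reflected ones of both parities.\<close>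

lemma rel_single_type:
  assumes "i \<in> {1..int n}" "j \<in> {1..int n}" "p i = i" "p j = j"
    and "i \<in> R \<Longrightarrow> j \<in> R \<Longrightarrow> i \<in> D \<longleftrightarrow> j \<in> D"
  shows "i \<approx> j"
proof -
  have p: "transpose i j (p k) = p (transpose i j k)" for k
    using assms(3,4) by (auto simp: transpose_def p_swap)
  show ?thesis
  proof (rule perm_in_H)
    show "k \<in> D \<longleftrightarrow> transpose i j k \<in> D" if "k \<in> R" "transpose i j k \<in> R" for k
      using that assms(5) by (auto simp: transpose_def split: if_splits)
  qed (use assms(1,2) in \<open>auto simp: p intro!: permutes_swap_id\<close>)
qed

text \<open>Within one 2-cycle the transposition centralises x. Otherwise conjugation turns (i, p
  i)(j, p j) into (i, p j)(j, p i), which lies in the same Klein four-group.\<close>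

lemma rel_moved:
  assumes "i \<in> {1..int n}" "j \<in> {1..int n}" "p i \<noteq> i" "p j \<noteq> j"
  shows "i \<approx> j"
proof -
  have R: "transpose i j k \<in> R \<longleftrightarrow> k \<in> R" and D: "transpose i j k \<in> D \<longleftrightarrow> k \<in> D" for k
    using assms(3,4) p_R D_sub by (auto simp: transpose_def)
  show ?thesis
  proof (rule perm_in_H)
    let ?t = "transpose i j"
    show "p (?t (p (?t k))) = ?t (p (?t (p k)))" for k
      using assms(3,4) by (auto simp: transpose_def p_swap)
  qed (use assms(1,2) in \<open>auto simp: R D intro!: permutes_swap_id\<close>)
qed

definition pair_swap :: "int \<Rightarrow> int \<Rightarrow> int \<Rightarrow> int \<Rightarrow> int" where
  "pair_swap a i j = transpose a i \<circ> transpose (p a) j"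

context
  fixes a i j
  assumes a: "a \<in> {1..int n}" "p a \<noteq> a"
    and ij: "i \<in> {1..int n}" "j \<in> {1..int n}" "i \<noteq> j" "p i = i" "p j = j"
    and type: "i \<in> R \<longleftrightarrow> j \<in> R" "i \<in> D \<longleftrightarrow> j \<in> D"
begin

lemma pair_swap_distinct: "a \<noteq> i" "a \<noteq> j" "p a \<noteq> i" "p a \<noteq> j"
  using a ij by (auto simp: p_swap)

lemma pair_swap_simps:
  "pair_swap a i j a = i" "pair_swap a i j i = a" "pair_swap a i j (p a) = j" "pair_swap a i j j = p a"
  "k \<notin> {a, p a, i, j} \<Longrightarrow> pair_swap a i j k = k"
  using pair_swap_distinct a ij by (auto simp: pair_swap_def transpose_def)

lemma pair_swap_permutes: "pair_swap a i j permutes {1..int n}"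
  unfolding pair_swap_def using a ij p_in[of a]
  by (intro permutes_compose permutes_swap_id) (auto simp del: p_in)

lemma pair_swap_invol: "pair_swap a i j (pair_swap a i j k) = k"
  using pair_swap_distinct a ij by (auto simp: pair_swap_def transpose_def)

text \<open>The conjugate has the 2-cycle (i, j) and acts on a and \<open>p a\<close> as x does on i
  and j. On each of the two pairs one involution swaps the coordinates while the other acts alike on
  both, so they commute; this is why i and j must have the same type.\<close>

lemma pair_swap_in_H: "perm_elem (pair_swap a i j) \<in> H"
proof (rule perm_in_H[OF pair_swap_permutes pair_swap_invol])
  let ?s = "pair_swap a i j"
  have nR: "a \<notin> R" "a \<notin> D" using a p_R D_sub by auto
  fix k
  \<comment> \<open>The four coordinates are closed under p, so off them the exchange fixes
    \<open>p k\<close> together with k.\<close>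
  consider "k = a" | "k = p a" | "k = i" | "k = j" | "k \<notin> {a, p a, i, j}" "p k \<notin> {a, p a, i, j}"
    using ij p_p by (metis insertE singletonD)
  note cases = this
  show "p (?s (p (?s k))) = ?s (p (?s (p k)))"
    by (cases rule: cases) (simp_all add: pair_swap_simps ij)
  show "?s (p (?s k)) \<in> R \<longleftrightarrow> k \<in> R" "?s (p k) \<in> R \<longleftrightarrow> ?s k \<in> R"
    by (cases rule: cases, simp_all add: pair_swap_simps ij nR type)+
  show "?s (p (?s k)) \<in> D \<longleftrightarrow> k \<in> D" "?s (p k) \<in> D \<longleftrightarrow> ?s k \<in> D"
    by (cases rule: cases, simp_all add: pair_swap_simps ij nR type)+
  show "k \<in> D \<longleftrightarrow> ?s k \<in> D" if "k \<in> R" "?s k \<in> R"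
    using that by (cases rule: cases) (simp_all add: pair_swap_simps ij nR type)
qed

text \<open>The exchange lies in H, swaps a with i and fixes k, so it carries either relation to the
  other.\<close>

lemma rel_pair_swap:
  assumes "k \<in> {1..int n}" "k \<notin> {a, p a, i, j}"
  shows "a \<approx> k \<longleftrightarrow> i \<approx> k"
proof -
  have "pair_swap a i j u \<approx> pair_swap a i j k" if "u \<in> {1..int n}" "u \<approx> k" for u
    using rel_perm[OF pair_swap_in_H pair_swap_permutes pair_swap_invol that(1) assms(1) that(2)] .
  from this[OF a(1)] this[OF ij(1)] show ?thesis
    using pair_swap_simps(5)[OF assms(2)] by (auto simp: pair_swap_simps(1,2))
qed

end

text \<open>On the line of a the involution x is the identity, so both elements centralise
  x.\<close>

lemma flip_shift_in_H_fixed: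
  assumes "a \<in> {1..int n}" "p a = a" "a \<notin> R"
  shows "flip_elem a \<in> H" "shift_elem a \<in> H"
proof -
  have D: "a \<notin> D" using assms D_sub by auto
  have "flip_elem a \<otimes>\<^bsub>affine_C n\<^esub> x = x \<otimes>\<^bsub>affine_C n\<^esub> flip_elem a"
  proof (rule affine_C_mult_eqI)
    fix k assume "k \<in> {1..int n}"
    then have "0 < k" "0 < p k" using p_pos[of k] by auto
    then show "fst x (fst (flip_elem a) k) = fst (flip_elem a) (fst x k) \<and>
       odd_ext (snd (flip_elem a)) (fst (flip_elem a) k) + odd_ext (snd x) (fst x (fst (flip_elem a) k)) =
       odd_ext (snd x) (fst x k) + odd_ext (snd (flip_elem a)) (fst (flip_elem a) (fst x k))"
      using assms D by (auto simp: flip_elem_def p_swap)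
  qed (fact normal_elem_carrier flip_elem_carrier[OF assms(1)])+
  then show "flip_elem a \<in> H"
    by (intro grp.reach_stab_commI[OF normal_elem_carrier flip_elem_carrier[OF assms(1)] normal_elem_carrier]) auto
  have "shift_elem a \<otimes>\<^bsub>affine_C n\<^esub> x = x \<otimes>\<^bsub>affine_C n\<^esub> shift_elem a"
  proof (rule affine_C_mult_eqI)
    fix k assume "k \<in> {1..int n}"
    then have "0 < k" "0 < p k" using p_pos[of k] by auto
    then show "fst x (fst (shift_elem a) k) = fst (shift_elem a) (fst x k) \<and>
       odd_ext (snd (shift_elem a)) (fst (shift_elem a) k) + odd_ext (snd x) (fst x (fst (shift_elem a) k)) =
       odd_ext (snd x) (fst x k) + odd_ext (snd (shift_elem a)) (fst (shift_elem a) (fst x k))"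
      using assms D by (auto simp: p_swap)
  qed (fact normal_elem_carrier shift_elem_carrier[OF assms(1)])+
  then show "shift_elem a \<in> H"
    by (intro grp.reach_stab_commI[OF normal_elem_carrier shift_elem_carrier[OF assms(1)] normal_elem_carrier]) auto
qed

lemma flip_shift_in_H_moved:
  assumes a: "a \<in> {1..int n}" "p a \<noteq> a"
  shows "flip_elem a \<in> H" "shift_elem a \<in> H"
proof -
  \<comment> \<open>The conjugates of x by the flip (y) and by the shift (z). In the plane of a and
    \<open>p a\<close>, x reflects in the diagonal, y in the line through 0 perpendicular to it, and
    z in a parallel of the diagonal. So x and z do not commute, but y commutes with both and joins
    them.\<close>
  define y where "y = ((\<lambda>k. if \<bar>k\<bar> = a \<or> \<bar>k\<bar> = p a then - fst x k else fst x k), snd x)"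
  define z where "z = (fst x, \<lambda>k. snd x k + (if k = a then 1 else if k = p a then - 1 else 0))"
  have pa: "0 < a" "0 < p a" using a p_pos[of a] by auto
  have nR: "a \<notin> R" "a \<notin> D" using a p_R D_sub by auto
  have xs: "fst x \<in> signed_perms n" "snd x \<in> int_vectors n"
    using normal_elem_carrier by (metis affine_C_carrier prod.collapse)+
  have y [simp]: "0 < k \<Longrightarrow> fst y k = (if k = a then - p a else if k = p a then - a else fst x k)"
    "fst y (- k) = - fst y k" "snd y = snd x" for k
    using pa nR by (auto simp: y_def)
  have z [simp]: "fst z = fst x"
    "0 < k \<Longrightarrow> odd_ext (snd z) k = odd_ext (snd x) k + (if k = a then 1 else if k = p a then - 1 else 0)" for k
    by (auto simp: z_def odd_ext_pos)
  have "fst y \<in> signed_perms n"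
  proof (rule signed_perms_involI_pos)
    fix k :: int assume "0 < k"
    then show "fst y (fst y k) = k" using p_pos[of k] pa nR by (auto simp: p_swap)
  next
    fix k :: int assume "int n < k"
    then show "fst y k = k" using a p_in[of a] p_outside[of k] R_sub by (auto simp del: p_in)
  qed simp
  then have y_carrier: "y \<in> carrier (affine_C n)"
    using xs(2) by (simp add: y_def affine_C_carrier)
  have z_carrier: "z \<in> carrier (affine_C n)"
    using xs a p_in[of a] by (auto simp: z_def affine_C_carrier int_vectors_def simp del: p_in)
  have fy: "flip_elem a \<otimes>\<^bsub>affine_C n\<^esub> y = x \<otimes>\<^bsub>affine_C n\<^esub> flip_elem a"
  proof (rule affine_C_mult_eqI)
    fix k assume "k \<in> {1..int n}"
    then have "0 < k" "0 < p k" using p_pos[of k] by auto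
    then show "fst y (fst (flip_elem a) k) = fst (flip_elem a) (fst x k) \<and>
       odd_ext (snd (flip_elem a)) (fst (flip_elem a) k) + odd_ext (snd y) (fst y (fst (flip_elem a) k)) =
       odd_ext (snd x) (fst x k) + odd_ext (snd (flip_elem a)) (fst (flip_elem a) (fst x k))"
      using a nR pa by (auto simp: flip_elem_def p_swap)
  qed (fact y_carrier normal_elem_carrier flip_elem_carrier[OF a(1)])+
  have sz: "shift_elem a \<otimes>\<^bsub>affine_C n\<^esub> z = x \<otimes>\<^bsub>affine_C n\<^esub> shift_elem a"
  proof (rule affine_C_mult_eqI)
    fix k assume "k \<in> {1..int n}"
    then have "0 < k" "0 < p k" using p_pos[of k] by auto
    then show "fst z (fst (shift_elem a) k) = fst (shift_elem a) (fst x k) \<and>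
       odd_ext (snd (shift_elem a)) (fst (shift_elem a) k) + odd_ext (snd z) (fst z (fst (shift_elem a) k)) =
       odd_ext (snd x) (fst x k) + odd_ext (snd (shift_elem a)) (fst (shift_elem a) (fst x k))"
      using a nR pa by (auto simp: p_swap)
  qed (fact z_carrier normal_elem_carrier shift_elem_carrier[OF a(1)])+
  have yx: "x \<otimes>\<^bsub>affine_C n\<^esub> y = y \<otimes>\<^bsub>affine_C n\<^esub> x"
  proof (rule affine_C_mult_eqI)
    fix k assume "k \<in> {1..int n}"
    then have "0 < k" "0 < p k" using p_pos[of k] by auto
    then show "fst y (fst x k) = fst x (fst y k) \<and>
       odd_ext (snd x) (fst x k) + odd_ext (snd y) (fst y (fst x k)) =
       odd_ext (snd y) (fst y k) + odd_ext (snd x) (fst x (fst y k))"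
      using a nR pa by (auto simp: p_swap)
  qed (fact y_carrier normal_elem_carrier)+
  have yz: "y \<otimes>\<^bsub>affine_C n\<^esub> z = z \<otimes>\<^bsub>affine_C n\<^esub> y"
  proof (rule affine_C_mult_eqI)
    fix k assume "k \<in> {1..int n}"
    then have "0 < k" "0 < p k" using p_pos[of k] by auto
    then show "fst z (fst y k) = fst y (fst z k) \<and>
       odd_ext (snd y) (fst y k) + odd_ext (snd z) (fst z (fst y k)) =
       odd_ext (snd z) (fst z k) + odd_ext (snd y) (fst y (fst z k))"
      using a nR pa by (auto simp: p_swap)
  qed (fact y_carrier z_carrier)+
  show F: "flip_elem a \<in> H"
    by (rule grp.reach_stab_commI[OF normal_elem_carrier flip_elem_carrier[OF a(1)] y_carrier fy yx])
  show "shift_elem a \<in> H"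
    by (rule grp.reach_stab_comm2I[OF normal_elem_carrier shift_elem_carrier[OF a(1)] z_carrier sz
          F y_carrier fy yz])
qed

end

section \<open>Conjugating an involution to normal form\<close>

lemma involution_normal_form:
  assumes x: "x \<in> carrier (affine_C n)" and xx: "x \<otimes>\<^bsub>affine_C n\<^esub> x = \<one>\<^bsub>affine_C n\<^esub>"
  obtains g p R D where "g \<in> carrier (affine_C n)" "normal_data n p R D"
    "g \<otimes>\<^bsub>affine_C n\<^esub> normal_elem p R D = x \<otimes>\<^bsub>affine_C n\<^esub> g"
proof -
  interpret group "affine_C n" by (rule group_affine_C)
  obtain \<sigma> v where e: "x = (\<sigma>, v)" by fastforce
  have s: "\<sigma> \<in> signed_perms n" and v: "v \<in> int_vectors n"
    using x by (simp_all add: e affine_C_carrier)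
  have one: "\<one>\<^bsub>affine_C n\<^esub> = (id, \<lambda>i. 0)" by (simp add: affine_C_def)
  have one_c: "(id, \<lambda>i. 0) \<in> carrier (affine_C n)" using one_closed by (simp add: one)
  have "(\<sigma>, v) \<otimes>\<^bsub>affine_C n\<^esub> (\<sigma>, v) = (id, \<lambda>i. 0) \<otimes>\<^bsub>affine_C n\<^esub> (id, \<lambda>i. 0)"
    using xx by (simp add: e one[symmetric])
  from affine_C_mult_eq_iff[OF x[unfolded e] x[unfolded e] one_c one_c, THEN iffD1, OF this]
  have sq: "\<forall>k\<in>{1..int n}. \<sigma> (\<sigma> k) = k \<and> odd_ext v (\<sigma> k) + odd_ext v (\<sigma> (\<sigma> k)) = 0"
    by (simp only: id_apply odd_ext_simps add_0)
  have *: "\<sigma> (\<sigma> k) = k" "odd_ext v (\<sigma> k) = - v k" if "k \<in> {1..int n}" for k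
    using bspec[OF sq that] that odd_ext_pos[of k v] by auto
  have neg: "\<sigma> (- k) = - \<sigma> k" for k by (rule signed_perms_neg[OF s])
  have abs: "\<bar>\<sigma> k\<bar> \<in> {1..int n}" "\<sigma> k \<noteq> 0" if "k \<in> {1..int n}" for k
    using signed_perms_abs_range[OF s that] by auto
  have abs_abs: "\<bar>\<sigma> \<bar>\<sigma> k\<bar>\<bar> = k" if "k \<in> {1..int n}" for k
    using *(1)[OF that] neg[of "\<sigma> k"] that by (cases "\<sigma> k > 0") auto
  define p where "p = (\<lambda>k. if k \<in> {1..int n} then \<bar>\<sigma> k\<bar> else k)"
  define R where "R = {k \<in> {1..int n}. \<sigma> k = - k}"
  define D where "D = {k \<in> R. odd (v k)}"
  have pp: "p (p k) = k" for k
    using abs(1)[of k] abs_abs[of k] by (auto simp: p_def)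
  have N: "normal_data n p R D"
  proof
    have "\<exists>!l. p l = k" for k using pp by metis
    then show "p permutes {1..int n}" by (auto simp: permutes_def p_def)
  qed (use pp in \<open>auto simp: R_def D_def p_def\<close>)
  \<comment> \<open>In a 2-cycle with j < k, the conjugator keeps the j-th coordinate of a point and
    replaces the k-th by the j-th coordinate of its image under x. As x is an involution, it
    exchanges these two values, so signs and shifts disappear. On a negated coordinate the
    translation by \<open>- (v k div 2)\<close> brings the centre, half of \<open>v k\<close>, to 0
    or 1/2.\<close>
  define \<tau> where "\<tau> = (\<lambda>k. if \<bar>\<sigma> \<bar>k\<bar>\<bar> < \<bar>k\<bar> then sgn (\<sigma> \<bar>k\<bar>) * k else k)"
  define u where "u = (\<lambda>k. if k \<notin> {1..int n} then 0 else if \<bar>\<sigma> k\<bar> < k then v \<bar>\<sigma> k\<bar>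
    else if \<sigma> k = - k then - (v k div 2) else 0)"
  have "\<tau> \<in> signed_perms n"
  proof (rule signed_perms_involI)
    fix k
    show "\<tau> (- k) = - \<tau> k" by (simp add: \<tau>_def)
    show "\<tau> k = k" if "int n < \<bar>k\<bar>" using that signed_perms_outside[OF s, of "\<bar>k\<bar>"] by (simp add: \<tau>_def)
    show "\<tau> (\<tau> k) = k"
      by (cases "\<sigma> \<bar>k\<bar>" "0::int" rule: linorder_cases)
        (use signed_perms_inj[OF s, of "\<bar>k\<bar>" 0] in \<open>auto simp: \<tau>_def signed_perms_zero[OF s]\<close>)
  qed
  moreover have "u \<in> int_vectors n" by (simp add: int_vectors_def u_def)
  ultimately have g: "(\<tau>, u) \<in> carrier (affine_C n)" by (simp add: affine_C_carrier)
  have "(\<tau>, u) \<otimes>\<^bsub>affine_C n\<^esub> normal_elem p R D = x \<otimes>\<^bsub>affine_C n\<^esub> (\<tau>, u)"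
  proof (rule affine_C_mult_eqI[OF g normal_data.normal_elem_carrier[OF N] x g])
    fix k assume k: "k \<in> {1..int n}"
    define j where "j = \<bar>\<sigma> k\<bar>"
    have j: "j \<in> {1..int n}" using abs(1)[OF k] by (simp add: j_def)
    have jk: "0 < j" "0 < k" using j k by auto
    have ext: "odd_ext u k = u k" "odd_ext u j = u j" "odd_ext v k = v k" "odd_ext v j = v j"
      using jk by (simp_all add: odd_ext_pos)
    have pk: "p k = j" "p j = k" using k j pp[of k] by (simp_all add: p_def j_def)
    have u_k: "u k = (if \<bar>\<sigma> k\<bar> < k then v \<bar>\<sigma> k\<bar> else if \<sigma> k = - k then - (v k div 2) else 0)"
      and u_j: "u j = (if \<bar>\<sigma> j\<bar> < j then v \<bar>\<sigma> j\<bar> else if \<sigma> j = - j then - (v j div 2) else 0)"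
      using j k by (simp_all add: u_def)
    consider (pos) "\<sigma> k = j" "\<sigma> j = k" "v j = - v k" | (neg) "\<sigma> k = - j" "\<sigma> j = - k" "v j = v k"
    proof (cases "\<sigma> k > 0")
      case True
      then have "\<sigma> k = j" by (simp add: j_def)
      with pos *[OF k] jk show ?thesis by (simp add: odd_ext_pos)
    next
      case False
      then have "\<sigma> k = - j" by (simp add: j_def)
      with neg *[OF k] jk signed_perms_neg[OF s, of j] show ?thesis by (simp add: odd_ext_pos)
    qed
    then show "fst (normal_elem p R D) (fst (\<tau>, u) k) = fst (\<tau>, u) (fst x k) \<and>
        odd_ext (snd (\<tau>, u)) (fst (\<tau>, u) k) +
          odd_ext (snd (normal_elem p R D)) (fst (normal_elem p R D) (fst (\<tau>, u) k)) =
        odd_ext (snd x) (fst x k) + odd_ext (snd (\<tau>, u)) (fst (\<tau>, u) (fst x k))"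
    proof cases
      case pos
      have nR: "k \<notin> R" "j \<notin> R" "k \<notin> D" "j \<notin> D" using pos jk by (auto simp: R_def D_def)
      consider "j = k" | "j < k" | "k < j" by linarith
      then show ?thesis
        by cases (use pos nR jk j k pk in \<open>auto simp: e ext \<tau>_def u_k u_j\<close>)
    next
      case neg
      consider "j = k" | "j < k" | "k < j" by linarith
      then show ?thesis
      proof cases
        case 1
        then have "k \<in> R" "k \<in> D \<longleftrightarrow> odd (v k)" using neg k by (auto simp: R_def D_def)
        moreover have "(if odd (v k) then 1 else 0) = v k - 2 * (v k div 2)"
          by (auto elim!: evenE oddE)
        ultimately show ?thesis
          using 1 neg jk k by (simp add: e ext \<tau>_def u_k)
      next
        case 2
        then have "k \<notin> R" "j \<notin> R" "k \<notin> D" "j \<notin> D" using neg jk by (auto simp: R_def D_def)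
        then show ?thesis
          using 2 neg jk j k pk by (auto simp: e ext \<tau>_def u_k u_j)
      next
        case 3
        then have "k \<notin> R" "j \<notin> R" "k \<notin> D" "j \<notin> D" using neg jk by (auto simp: R_def D_def)
        then show ?thesis
          using 3 neg jk j k pk by (auto simp: e ext \<tau>_def u_k u_j)
      qed
    qed
  qed
  with that g N show thesis by blast
qed

section \<open>Connectedness outside the exceptional cases\<close>

context normal_data
begin

definition "moved = {i \<in> {1..int n}. p i \<noteq> i}"
definition "free = {i \<in> {1..int n}. i \<notin> R \<and> p i = i}"

lemma moved_subset: "moved \<subseteq> {1..int n}" and free_subset: "free \<subseteq> {1..int n}"
  by (auto simp: moved_def free_def)

lemma finite_parts: "finite moved" "finite free" "finite R" "finite D"
  using moved_subset free_subset R_sub D_sub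
  by (meson finite_subset finite_atLeastAtMost_int subset_trans)+

lemma moved_cases:
  "k \<in> {1..int n} \<Longrightarrow> k \<in> moved \<or> k \<in> free \<or> k \<in> R - D \<or> k \<in> D"
  by (auto simp: moved_def free_def)

lemma two_cycles_normal: "two_cycles n (fst x) = (\<lambda>i. {i, p i}) ` moved"
proof -
  have "\<bar>fst x i\<bar> = p i" if "i \<in> {1..int n}" for i
    using that p_pos[of i] p_R[of i] by auto
  then have "two_cycles n (fst x) = {{i, j} |i j. i \<in> {1..int n} \<and> j \<in> {1..int n} \<and> i \<noteq> j \<and> p i = j \<and> p j = i}"
    unfolding two_cycles_def by (intro Collect_cong ex_cong1 conj_cong refl) auto
  also have "\<dots> = (\<lambda>i. {i, p i}) ` moved"
    unfolding moved_def using p_in by (auto simp del: p_in atLeastAtMost_iff simp: image_iff)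
  finally show ?thesis .
qed

lemma labelled_cycle_type_normal:
  "labelled_cycle_type n x = (card ((\<lambda>i. {i, p i}) ` moved), card (R - D), card D, card free)"
proof -
  have s: "fst x i = - i \<longleftrightarrow> i \<in> R" "fst x i = i \<longleftrightarrow> i \<notin> R \<and> p i = i"
    if "i \<in> {1..int n}" for i
    using that p_pos[of i] by auto
  have snd: "snd x i = (if i \<in> D then 1 else 0)" for i by (simp add: normal_elem_def)
  have "{i \<in> {1..int n}. fst x i = - i \<and> even (snd x i)} = R - D"
    using R_sub s(1) by (auto simp: snd simp del: normal_elem_simps atLeastAtMost_iff)
  moreover have "{i \<in> {1..int n}. fst x i = - i \<and> odd (snd x i)} = D"
    using R_sub D_sub s(1) by (auto simp: snd simp del: normal_elem_simps atLeastAtMost_iff)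
  moreover have "{i \<in> {1..int n}. fst x i = i} = free"
    using s(2) by (auto simp: free_def simp del: normal_elem_simps atLeastAtMost_iff)
  ultimately show ?thesis
    unfolding labelled_cycle_type_def two_cycles_normal[symmetric] by (simp add: case_prod_unfold)
qed

lemma moved_eq_pair:
  assumes "card ((\<lambda>i. {i, p i}) ` moved) = 1" "a \<in> moved"
  shows "moved = {a, p a}"
proof -
  obtain S where S: "(\<lambda>i. {i, p i}) ` moved = {S}" using assms(1) by (rule card_1_singletonE)
  have "{b, p b} = S" if "b \<in> moved" for b
    using imageI[OF that, of "\<lambda>i. {i, p i}"] unfolding S by simp
  then have "{b, p b} = {a, p a}" if "b \<in> moved" for b using that assms(2) by metis
  then have "moved \<subseteq> {a, p a}" by blast
  moreover have "p a \<in> moved" using assms(2) p_in[of a] by (auto simp: moved_def p_swap simp del: p_in)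
  ultimately show ?thesis using assms(2) by auto
qed

lemma other_moved:
  assumes "card ((\<lambda>i. {i, p i}) ` moved) \<noteq> 1" "a \<in> moved"
  obtains b where "b \<in> moved" "b \<notin> {a, p a}"
proof -
  have "\<not> moved \<subseteq> {a, p a}"
  proof
    assume *: "moved \<subseteq> {a, p a}"
    have "p a \<in> moved" using assms(2) p_in[of a] by (auto simp: moved_def p_swap simp del: p_in)
    with * assms(2) have "moved = {a, p a}" by auto
    then have "(\<lambda>i. {i, p i}) ` moved = {{a, p a}}" by auto
    with assms(1) show False by simp
  qed
  with that show thesis by blast
qed

text \<open>The exchange makes \<open>a \<approx> k\<close> and \<open>i \<approx> k\<close>
  equivalent, so k is a bridge from a to i. It must lie off the four exchanged coordinates in order
  to stay fixed.\<close>

lemma rel_link: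
  assumes a: "a \<in> moved" and T: "T \<in> {R - D, D, free}" "i \<in> T" "j \<in> T" "i \<noteq> j"
    and k: "k \<in> {1..int n}" "k \<notin> {a, p a, i, j}" "a \<approx> k \<or> i \<approx> k"
  shows "a \<approx> i"
proof -
  have ij: "i \<in> {1..int n}" "j \<in> {1..int n}" "p i = i" "p j = j"
    "i \<in> R \<longleftrightarrow> j \<in> R" "i \<in> D \<longleftrightarrow> j \<in> D"
    using T R_sub D_sub p_R by (auto simp: free_def)
  have a': "a \<in> {1..int n}" "p a \<noteq> a" using a by (auto simp: moved_def)
  have "a \<approx> k" "i \<approx> k"
    using rel_pair_swap[OF a' ij(1,2) T(4) ij(3-6) k(1,2)] k(3) by auto
  then show ?thesis
    using rel_trans[OF a'(1) k(1) ij(1)] rel_sym by blast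
qed

lemma rel_same_part:
  assumes "T \<in> {R - D, D, free}" "i \<in> T" "j \<in> T"
  shows "i \<approx> j"
proof (rule rel_single_type)
  show "i \<in> {1..int n}" "j \<in> {1..int n}" "p i = i" "p j = j"
    using assms R_sub D_sub p_R by (auto simp: free_def)
  show "i \<in> D \<longleftrightarrow> j \<in> D" using assms D_sub by (auto simp: free_def)
qed

text \<open>A free coordinate is related to every unmoved one and thereby bridges the two parities
  of reflections.\<close>

lemma rel_unmoved:
  assumes "free \<noteq> {}" "i \<in> {1..int n} - moved" "j \<in> {1..int n} - moved"
  shows "i \<approx> j"
proof -
  obtain f where f: "f \<in> free" using assms by blast
  have *: "f \<approx> k" if "k \<in> {1..int n} - moved" for k
    using that f by (intro rel_single_type) (auto simp: free_def moved_def)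
  from f have "f \<in> {1..int n}" by (simp add: free_def)
  then show ?thesis
    using *[OF assms(2)] *[OF assms(3)] rel_trans[of i f j] rel_sym assms(2,3) by blast
qed

lemma ex_other:
  assumes "S \<subseteq> {1..int n}" "card S \<noteq> n"
  obtains k where "k \<in> {1..int n}" "k \<notin> S"
proof -
  have "S \<noteq> {1..int n}" using assms(2) by auto
  with assms(1) that show thesis by blast
qed

text \<open>Counts the exchanged coordinates, so that a fifth one exists unless n = 4.\<close>

lemma card_four: "a \<in> moved \<Longrightarrow> i \<notin> moved \<Longrightarrow> j \<notin> moved \<Longrightarrow> i \<noteq> j \<Longrightarrow>
    i \<in> {1..int n} \<Longrightarrow> j \<in> {1..int n} \<Longrightarrow>
    {a, p a, i, j} \<subseteq> {1..int n} \<and> card {a, p a, i, j} = 4"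
  using p_in[of a] by (auto simp: moved_def p_swap card_insert_if simp del: p_in)

lemma two_elements:
  assumes "finite T" "2 \<le> card T"
  obtains i j where "i \<in> T" "j \<in> T" "i \<noteq> j"
  using assms by (metis card_le_Suc0_iff_eq not_less_eq_eq numeral_2_eq_2)

lemma part_unmoved: "T \<in> {R - D, D, free} \<Longrightarrow> T \<subseteq> {1..int n} - moved"
  using R_sub D_sub p_R by (auto simp: free_def moved_def)

lemma finite_part: "T \<in> {R - D, D, free} \<Longrightarrow> finite T"
  using finite_parts by auto

text \<open>If there are 2-cycles, their coordinates are related to each other, and it remains to
  join one of them, a, to the unmoved ones. \<open>rel_link\<close> does so from two coordinates of
  one type and a bridge; the excluded cases are those in which the pair or the bridge is
  missing.\<close>

lemma connected_all_related:
  assumes m: "m = card ((\<lambda>i. {i, p i}) ` moved)"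
    and c1: "\<not> (moved = {} \<and> free = {})"
    and c2: "\<not> (moved \<noteq> {} \<and> free = {} \<and> (card (R - D) = 1 \<or> card D = 1))"
    and c3: "\<not> (moved \<noteq> {} \<and> max (card (R - D)) (max (card D) (card free)) = 1)"
    and c4: "\<not> (n = 4 \<and> m = 1)"
    and c5: "\<not> (n = 6 \<and> m = 1 \<and> card (R - D) = 2 \<and> card D = 2)"
  shows "\<forall>i\<in>{1..int n}. \<forall>j\<in>{1..int n}. i \<approx> j"
proof (cases "moved = {}")
  case True
  with c1 show ?thesis using rel_unmoved by auto
next
  case False
  then obtain a where a: "a \<in> moved" by blast
  have a_n: "a \<in> {1..int n}" using a moved_subset by blast
  have M: "a \<approx> b" if "b \<in> moved" for b
    using that a by (intro rel_moved) (auto simp: moved_def)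
  have link: "a \<approx> i" if T: "T \<in> {R - D, D, free}" "i \<in> T" "2 \<le> card T"
    and k: "m = 1 \<Longrightarrow> (\<And>j. j \<in> T \<Longrightarrow> j \<noteq> i \<Longrightarrow> \<exists>k\<in>{1..int n}. k \<notin> {a, p a, i, j} \<and> (a \<approx> k \<or> i \<approx> k))"
    for T i
  proof -
    obtain j where j: "j \<in> T" "j \<noteq> i" using two_elements[OF finite_part[OF T(1)] T(3)] by metis
    have "\<exists>k\<in>{1..int n}. k \<notin> {a, p a, i, j} \<and> (a \<approx> k \<or> i \<approx> k)"
    proof (cases "m = 1")
      case False
      \<comment> \<open>A coordinate of a second 2-cycle is a bridge, being related to a by
        \<open>rel_moved\<close>.\<close>
      then obtain b where b: "b \<in> moved" "b \<notin> {a, p a}" using other_moved a m by metis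
      then have "b \<notin> {a, p a, i, j}" using part_unmoved[OF T(1)] T(2) j by blast
      with b M moved_subset show ?thesis by blast
    qed (use k j in blast)
    then show ?thesis using rel_link[OF a T(1,2) j(1)] j(2) by blast
  qed
  have "a \<approx> i" if i: "i \<in> {1..int n}" for i
  proof (cases "free = {}")
    case False
    \<comment> \<open>The largest of the three counts is positive and not 1, so some type has two
      members. Joining a to one of them is enough, since a free coordinate makes all unmoved ones
      related.\<close>
    then have "card free \<noteq> 0" using finite_parts by simp
    with c3 \<open>moved \<noteq> {}\<close> have "2 \<le> card (R - D) \<or> 2 \<le> card D \<or> 2 \<le> card free" by linarith
    then obtain T where T: "T \<in> {R - D, D, free}" "2 \<le> card T" by blast
    then have "T \<noteq> {}" by auto
    then obtain t where t: "t \<in> T" by blast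
    have "a \<approx> t"
    proof (rule link[OF T(1) t T(2)])
      fix j assume m1: "m = 1" and j: "j \<in> T" "j \<noteq> t"
      have "{a, p a, t, j} \<subseteq> {1..int n} \<and> card {a, p a, t, j} = 4"
        using part_unmoved[OF T(1)] t j by (intro card_four[OF a]) auto
      then obtain k where k: "k \<in> {1..int n}" "k \<notin> {a, p a, t, j}"
        using ex_other[of "{a, p a, t, j}"] c4 m1 by metis
      have "k \<notin> moved" using moved_eq_pair[of a] m m1 a k by auto
      then have "t \<approx> k" using rel_unmoved[OF False] k part_unmoved[OF T(1)] t by blast
      with k show "\<exists>k\<in>{1..int n}. k \<notin> {a, p a, t, j} \<and> (a \<approx> k \<or> t \<approx> k)" by blast
    qed
    moreover have "t \<approx> i" if "i \<notin> moved"
      using rel_unmoved[OF False, of t i] that i part_unmoved[OF T(1)] t by blast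
    moreover have "t \<in> {1..int n}" using part_unmoved[OF T(1)] t by blast
    ultimately show ?thesis
      using M rel_trans[OF a_n _ i] by (cases "i \<in> moved") blast+
  next
    case True
    have parts: "k \<in> moved \<or> k \<in> R - D \<or> k \<in> D" if "k \<in> {1..int n}" for k
      using moved_cases[OF that] True by blast
    \<comment> \<open>Without free coordinates the two parities have to be joined to a separately,
      so each nonempty one must offer two members.\<close>
    have large: "2 \<le> card T" if "T \<in> {R - D, D}" "i \<in> T" for T i
    proof -
      have "card T \<noteq> 1" using that c2 True \<open>moved \<noteq> {}\<close> by auto
      moreover have "card T \<noteq> 0" using that finite_part[of T] by (auto simp del: card_gt_0_iff simp: card_eq_0_iff)
      ultimately show ?thesis by linarith
    qed
    have pa: "p a \<in> moved" using a p_in[of a] by (auto simp: moved_def p_swap simp del: p_in)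
    \<comment> \<open>A third member of the type is the bridge.\<close>
    have link3: "a \<approx> t" if T: "T \<in> {R - D, D}" "t \<in> T" "3 \<le> card T" for T t
    proof (rule link[of T])
      fix j assume j: "j \<in> T" "j \<noteq> t"
      have "\<not> T \<subseteq> {t, j}" using T(3) card_mono[of "{t, j}" T] j by auto
      then obtain k where k: "k \<in> T" "k \<notin> {t, j}" by blast
      have "t \<approx> k" using T k by (intro rel_same_part[of T]) auto
      moreover have "k \<in> {1..int n}" "k \<notin> moved" using part_unmoved[of T] T(1) k(1) by blast+
      moreover from this(2) have "k \<notin> {a, p a, t, j}" using k(2) a pa by blast
      ultimately show "\<exists>k\<in>{1..int n}. k \<notin> {a, p a, t, j} \<and> (a \<approx> k \<or> t \<approx> k)"
        by blast
    qed (use T in auto)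
    have case_part: "a \<approx> i" if TU: "{T, U} = {R - D, D}" and iT: "i \<in> T" for T U
    proof -
      have part: "T \<in> {R - D, D}" "U \<in> {R - D, D}" using TU by auto
      show ?thesis
      proof (cases "m = 1")
        case m1: False
        with part(1) show ?thesis using large[OF part(1) iT] iT by (intro link[of T]) auto
      next
        case m1: True
        have disj: "T \<inter> U = {}" using TU by (auto simp: doubleton_eq_iff)
        consider "3 \<le> card T" | "3 \<le> card U" | "card T = 2" "card U \<le> 2"
          using large[OF part(1) iT] by linarith
        then show ?thesis
        proof cases
          case 1
          then show ?thesis by (rule link3[OF part(1) iT])
        next
          case 2
          \<comment> \<open>U is joined to a by means of its own third member; any member of U is
            then a bridge for T.\<close>
          then have "U \<noteq> {}" by auto
          then obtain k where k: "k \<in> U" by blast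
          then have ak: "a \<approx> k" using link3[OF part(2) k 2] by simp
          have k': "k \<in> {1..int n}" "k \<notin> moved" using part_unmoved[of U] part k by blast+
          show ?thesis
          proof (rule link[of T])
            fix j assume "j \<in> T" "j \<noteq> i"
            then have "k \<notin> {a, p a, i, j}" using k k' a pa disj iT by blast
            with ak k' show "\<exists>k\<in>{1..int n}. k \<notin> {a, p a, i, j} \<and> (a \<approx> k \<or> i \<approx> k)" by blast
          qed (use part iT large[of T] in auto)
        next
          case 3
          \<comment> \<open>No bridge is at hand here. Since U has 0 or 2 members, n is 2 + 2 or 2 +
            2 + 2: the two sporadic exceptions.\<close>
          have R: "T \<union> U = R" using TU D_sub by (auto simp: doubleton_eq_iff)
          have "{1..int n} = moved \<union> (T \<union> U)"
          proof
            show "{1..int n} \<subseteq> moved \<union> (T \<union> U)" unfolding R using parts D_sub by fast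
            show "moved \<union> (T \<union> U) \<subseteq> {1..int n}" unfolding R using moved_subset R_sub by simp
          qed
          moreover have "moved \<inter> (T \<union> U) = {}" unfolding R using p_R by (auto simp: moved_def)
          moreover have "finite T" "finite U" using finite_part part by auto
          ultimately have "card {1..int n} = card moved + (card T + card U)"
            using finite_parts disj by (simp add: card_Un_disjoint)
          moreover have "card moved = 2"
            using moved_eq_pair[of a] m m1 a by (auto simp: moved_def)
          moreover have "card U \<noteq> 1" using part c2 True \<open>moved \<noteq> {}\<close> by auto
          ultimately have "n = 4 \<or> n = 6 \<and> card U = 2" using 3 by (auto simp: le_Suc_eq numeral_2_eq_2)
          moreover have "card U = 2 \<Longrightarrow> card (R - D) = 2 \<and> card D = 2"
            using 3(1) TU by (auto simp: doubleton_eq_iff)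
          ultimately show ?thesis using c4 c5 m1 by blast
        qed
      qed
    qed
    from parts[OF i] show ?thesis
      using M case_part[of "R - D" D] case_part[of D "R - D"] by (auto simp: insert_commute)
  qed
  then have *: "a \<approx> i" if "i \<in> {1..int n}" for i using that by blast
  show ?thesis
  proof (intro ballI)
    fix i j assume "i \<in> {1..int n}" "j \<in> {1..int n}"
    then show "i \<approx> j" using rel_trans[OF _ a_n _ rel_sym[OF *] *] by blast
  qed
qed

lemma connected_normal:
  assumes n: "1 \<le> n" and type: "labelled_cycle_type n x = (m, k\<^sub>e, k\<^sub>o, l)"
    and "\<not> (m = 0 \<and> l = 0)"
    and "\<not> (m > 0 \<and> l = 0 \<and> (k\<^sub>e = 1 \<or> k\<^sub>o = 1))"
    and "\<not> (m > 0 \<and> max k\<^sub>e (max k\<^sub>o l) = 1)"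
    and "\<not> (n = 4 \<and> m = 1)"
    and "\<not> (n = 6 \<and> m = 1 \<and> k\<^sub>e = 2 \<and> k\<^sub>o = 2)"
  shows "connected (with_proj (commuting_graph (affine_C n) (conjugacy_class (affine_C n) x)))"
proof -
  have c: "m = card ((\<lambda>i. {i, p i}) ` moved)" "k\<^sub>e = card (R - D)" "k\<^sub>o = card D" "l = card free"
    using type by (simp_all add: labelled_cycle_type_normal)
  have e: "m = 0 \<longleftrightarrow> moved = {}" "l = 0 \<longleftrightarrow> free = {}"
    using finite_parts by (simp_all add: c)
  have "\<forall>i\<in>{1..int n}. \<forall>j\<in>{1..int n}. i \<approx> j"
    by (rule connected_all_related[OF c(1)];
        use assms(3-7) in \<open>unfold neq0_conv[symmetric] e c(2-4)[symmetric]\<close>; assumption)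
  \<comment> \<open>Since not everything is reflected, some coordinate is moved or free, and there H
    contains the flip and the shift. With all transpositions these generate the whole group.\<close>
  moreover have "moved \<noteq> {} \<or> free \<noteq> {}" using assms(3) e by blast
  then obtain a where a: "a \<in> {1..int n}" "flip_elem a \<in> H" "shift_elem a \<in> H"
    using flip_shift_in_H_moved flip_shift_in_H_fixed by (auto simp: moved_def free_def)
  ultimately have "carrier (affine_C n) \<subseteq> H"
    by (intro affine_C_generated[OF H_subgroup]) auto
  then show ?thesis
    by (simp add: grp.connected_commuting_graph_iff_reach_stab[OF normal_elem_carrier])
qed

end

section \<open>Disconnected cases\<close>

text \<open>This and the next two sets are read off from arbitrary elements, because an invariant
  has to be compared on all conjugates and not only on normal forms.\<close>

definition moved_set :: "nat \<Rightarrow> (int \<Rightarrow> int) \<times> (int \<Rightarrow> int) \<Rightarrow> int set" where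
  "moved_set n y = {i \<in> {1..int n}. \<bar>fst y i\<bar> \<noteq> i}"

definition neg_set :: "nat \<Rightarrow> bool \<Rightarrow> (int \<Rightarrow> int) \<times> (int \<Rightarrow> int) \<Rightarrow> int set" where
  "neg_set n b y = {i \<in> {1..int n}. fst y i = - i \<and> (even (snd y i) \<longleftrightarrow> b)}"

definition fixed_set :: "nat \<Rightarrow> (int \<Rightarrow> int) \<times> (int \<Rightarrow> int) \<Rightarrow> int set" where
  "fixed_set n y = {i \<in> {1..int n}. fst y i = i}"

lemma finite_sets: "finite (moved_set n y)" "finite (neg_set n b y)" "finite (fixed_set n y)"
  by (rule finite_subset[of _ "{1..int n}"]; auto simp: moved_set_def neg_set_def fixed_set_def)+

lemma labelled_cycle_type_sets:
  "labelled_cycle_type n y =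
    (card (two_cycles n (fst y)), card (neg_set n True y), card (neg_set n False y), card (fixed_set n y))"
  by (simp add: labelled_cycle_type_def neg_set_def fixed_set_def case_prod_unfold)

lemma set_cases:
  "i \<in> {1..int n} \<Longrightarrow> i \<notin> moved_set n y \<Longrightarrow>
    i \<in> fixed_set n y \<or> i \<in> neg_set n b y \<or> i \<in> neg_set n (\<not> b) y"
  by (auto simp: moved_set_def neg_set_def fixed_set_def)

lemma abs_fst_abs:
  assumes "y \<in> carrier (affine_C n)"
  shows "\<bar>fst y \<bar>k\<bar>\<bar> = \<bar>fst y k\<bar>"
proof -
  have "fst y (- k) = - fst y k"
    using assms by (intro signed_perms_neg[of _ n]) (metis affine_C_carrier prod.collapse)
  then show ?thesis by (simp add: abs_if)
qed

lemma affine_C_mult_eqD: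
  assumes "a \<in> carrier (affine_C n)" "b \<in> carrier (affine_C n)"
    and "c \<in> carrier (affine_C n)" "d \<in> carrier (affine_C n)"
    and "a \<otimes>\<^bsub>affine_C n\<^esub> b = c \<otimes>\<^bsub>affine_C n\<^esub> d" "k \<in> {1..int n}"
  shows "fst b (fst a k) = fst d (fst c k)"
    and "odd_ext (snd a) (fst a k) + odd_ext (snd b) (fst b (fst a k)) =
      odd_ext (snd c) (fst c k) + odd_ext (snd d) (fst d (fst c k))"
proof -
  note iff = affine_C_mult_eq_iff[of "fst a" "snd a" n "fst b" "snd b" "fst c" "snd c" "fst d" "snd d",
      unfolded prod.collapse]
  note eq = iff[OF assms(1-4), THEN iffD1, OF assms(5), THEN bspec, OF assms(6)]
  show "fst b (fst a k) = fst d (fst c k)" by (rule eq[THEN conjunct1])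
  show "odd_ext (snd a) (fst a k) + odd_ext (snd b) (fst b (fst a k)) =
      odd_ext (snd c) (fst c k) + odd_ext (snd d) (fst d (fst c k))" by (rule eq[THEN conjunct2])
qed

section \<open>What commuting involutions preserve of each other\<close>

locale commuting_pair =
  fixes n :: nat and y z :: "(int \<Rightarrow> int) \<times> (int \<Rightarrow> int)"
  assumes y: "y \<in> carrier (affine_C n)" and z: "z \<in> carrier (affine_C n)"
    and yy: "y \<otimes>\<^bsub>affine_C n\<^esub> y = \<one>\<^bsub>affine_C n\<^esub>" and zz: "z \<otimes>\<^bsub>affine_C n\<^esub> z = \<one>\<^bsub>affine_C n\<^esub>"
    and comm: "y \<otimes>\<^bsub>affine_C n\<^esub> z = z \<otimes>\<^bsub>affine_C n\<^esub> y"
begin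

lemma commuting_pair_sym: "commuting_pair n z y"
  using y z yy zz comm by (simp add: commuting_pair_def)

lemma signed: "fst y \<in> signed_perms n" "fst z \<in> signed_perms n"
  using y z by (metis affine_C_carrier prod.collapse)+

lemma fst_neg: "fst y (- k) = - fst y k" "fst z (- k) = - fst z k"
  using signed by (simp_all add: signed_perms_neg)

lemma fst_comm: "k \<in> {1..int n} \<Longrightarrow> fst z (fst y k) = fst y (fst z k)"
  by (rule affine_C_mult_eqD[OF y z z y comm])

lemma snd_comm: "k \<in> {1..int n} \<Longrightarrow> odd_ext (snd y) (fst y k) + odd_ext (snd z) (fst z (fst y k)) =
    odd_ext (snd z) (fst z k) + odd_ext (snd y) (fst y (fst z k))"
  by (rule affine_C_mult_eqD[OF y z z y comm])

lemma abs_range: "k \<in> {1..int n} \<Longrightarrow> \<bar>fst y k\<bar> \<in> {1..int n}" "k \<in> {1..int n} \<Longrightarrow> \<bar>fst z k\<bar> \<in> {1..int n}"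
  using signed signed_perms_abs_range(1) by blast+

lemma fst_invol:
  assumes k: "k \<in> {1..int n}"
  shows "fst z (fst z k) = k"
proof -
  interpret group "affine_C n" by (rule group_affine_C)
  have "z \<otimes>\<^bsub>affine_C n\<^esub> z = \<one>\<^bsub>affine_C n\<^esub> \<otimes>\<^bsub>affine_C n\<^esub> \<one>\<^bsub>affine_C n\<^esub>" using zz by simp
  from affine_C_mult_eqD(1)[OF z z one_closed one_closed this k] show ?thesis
    by (simp add: affine_C_def)
qed

lemma abs_comm: "k \<in> {1..int n} \<Longrightarrow> \<bar>fst y \<bar>fst z k\<bar>\<bar> = \<bar>fst z \<bar>fst y k\<bar>\<bar>"
  using fst_comm by (simp add: abs_fst_abs[OF y] abs_fst_abs[OF z])

lemma abs_invol: "k \<in> {1..int n} \<Longrightarrow> \<bar>fst z \<bar>fst z k\<bar>\<bar> = k"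
  using fst_invol by (simp add: abs_fst_abs[OF z])

text \<open>Commuting permutations preserve each other's fixed points, hence also the
  complement.\<close>

lemma moved_set_invariant:
  assumes k: "k \<in> {1..int n}"
  shows "\<bar>fst z k\<bar> \<in> moved_set n y \<longleftrightarrow> k \<in> moved_set n y"
proof -
  have "\<bar>fst y \<bar>fst z k\<bar>\<bar> = \<bar>fst z k\<bar> \<longleftrightarrow> \<bar>fst y k\<bar> = k"
    using abs_comm[OF k] abs_invol[OF k] abs_invol[OF abs_range(1)[OF k]] by metis
  then show ?thesis using k abs_range(2)[OF k] by (simp add: moved_set_def)
qed

lemma fixed_set_invariant:
  assumes k: "k \<in> fixed_set n y"
  shows "\<bar>fst z k\<bar> \<in> fixed_set n y"
proof -
  have k': "k \<in> {1..int n}" "fst y k = k" using k by (auto simp: fixed_set_def)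
  then have "fst y (fst z k) = fst z k" using fst_comm[OF k'(1)] by simp
  then show ?thesis
    using abs_range(2)[OF k'(1)] fst_neg(1)[of "fst z k"] by (simp add: fixed_set_def abs_if)
qed

text \<open>The entry of y at a negated coordinate is twice the centre of its reflection. Commuting
  with y, z carries centres to centres by a sign and an integral shift, which keeps the parity of
  twice the centre; if z reflects the same line, the centres coincide.\<close>

lemma neg_set_invariant:
  assumes k: "k \<in> neg_set n b y"
  shows "\<bar>fst z k\<bar> \<in> neg_set n b y"
    and "fst z k = - k \<Longrightarrow> snd z k = snd y k"
proof -
  have k': "k \<in> {1..int n}" "fst y k = - k" "even (snd y k) \<longleftrightarrow> b" using k by (auto simp: neg_set_def)
  have zk: "fst y (fst z k) = - fst z k" using fst_comm[OF k'(1)] k'(2) by (simp add: fst_neg)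
  have eq: "odd_ext (snd y) (fst z k) = snd y k + 2 * odd_ext (snd z) (fst z k)"
    using snd_comm[OF k'(1)] k' zk by (simp add: fst_neg odd_ext_pos)
  have "fst z k \<noteq> 0" using abs_range(2)[OF k'(1)] by auto
  then have "even (snd y \<bar>fst z k\<bar>) \<longleftrightarrow> even (odd_ext (snd y) (fst z k))"
    by (auto simp: odd_ext_def sgn_if)
  also have "\<dots> \<longleftrightarrow> even (snd y k)" by (simp add: eq)
  finally show "\<bar>fst z k\<bar> \<in> neg_set n b y"
    using abs_range(2)[OF k'(1)] fst_neg(1)[of "fst z k"] zk k'(3)
    by (auto simp: neg_set_def abs_if)
  show "snd z k = snd y k" if "fst z k = - k"
    using eq k'(1) by (simp add: that odd_ext_pos)
qed

end

lemma two_cycles_moved: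
  assumes "commuting_pair n y y" and i: "i \<in> moved_set n y"
  shows "{i, \<bar>fst y i\<bar>} \<in> two_cycles n (fst y)"
proof -
  interpret commuting_pair n y y by fact
  have i': "i \<in> {1..int n}" "\<bar>fst y i\<bar> \<noteq> i" using i by (auto simp: moved_set_def)
  then show ?thesis
    using abs_invol[OF i'(1)] abs_range[OF i'(1)] unfolding two_cycles_def by blast
qed

lemma finite_two_cycles: "finite (two_cycles n \<sigma>)"
  by (rule finite_subset[of _ "Pow {1..int n}"]) (auto simp: two_cycles_def)

lemma moved_set_empty_iff:
  assumes "commuting_pair n y y"
  shows "moved_set n y = {} \<longleftrightarrow> card (two_cycles n (fst y)) = 0"
proof
  assume "moved_set n y = {}"
  then have "two_cycles n (fst y) = {}" by (auto simp: two_cycles_def moved_set_def)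
  then show "card (two_cycles n (fst y)) = 0" by simp
next
  assume "card (two_cycles n (fst y)) = 0"
  then show "moved_set n y = {}"
    using two_cycles_moved[OF assms] finite_two_cycles[of n "fst y"] by auto
qed

lemma moved_set_pair:
  assumes "commuting_pair n y y" "card (two_cycles n (fst y)) = 1" and i: "i \<in> moved_set n y"
  shows "moved_set n y = {i, \<bar>fst y i\<bar>}"
proof
  interpret commuting_pair n y y by fact
  obtain S where S: "two_cycles n (fst y) = {S}" using assms(2) by (rule card_1_singletonE)
  show "moved_set n y \<subseteq> {i, \<bar>fst y i\<bar>}"
  proof
    fix j assume "j \<in> moved_set n y"
    from two_cycles_moved[OF assms(1) this] two_cycles_moved[OF assms(1) i]
    have "{j, \<bar>fst y j\<bar>} = {i, \<bar>fst y i\<bar>}" unfolding S by simp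
    then show "j \<in> {i, \<bar>fst y i\<bar>}" by blast
  qed
  have "i \<in> {1..int n}" using i by (simp add: moved_set_def)
  then show "{i, \<bar>fst y i\<bar>} \<subseteq> moved_set n y"
    using i moved_set_invariant[of i] by simp
qed

lemma card_moved_set_pair:
  assumes "commuting_pair n y y" "card (two_cycles n (fst y)) = 1"
  shows "card (moved_set n y) = 2"
proof -
  have "moved_set n y \<noteq> {}" using moved_set_empty_iff[OF assms(1)] assms(2) by simp
  then obtain i where i: "i \<in> moved_set n y" by blast
  then have "\<bar>fst y i\<bar> \<noteq> i" by (simp add: moved_set_def)
  then show ?thesis using moved_set_pair[OF assms i] by simp
qed

text \<open>The transposition of b and c turns the 2-cycle (a, b) of x into (a, c). The moved set of
  the conjugate thus meets that of x without being contained in it.\<close>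

lemma conj_moves:
  assumes x: "x \<in> carrier (affine_C n)" and a: "b \<in> moved_set n x"
    and c: "c \<in> {1..int n}" "c \<notin> moved_set n x" and xx: "commuting_pair n x x"
  obtains g a where "g \<in> carrier (affine_C n)" "a \<in> moved_set n x"
    "a \<in> moved_set n (inv\<^bsub>affine_C n\<^esub> g \<otimes>\<^bsub>affine_C n\<^esub> x \<otimes>\<^bsub>affine_C n\<^esub> g)"
    "c \<in> moved_set n (inv\<^bsub>affine_C n\<^esub> g \<otimes>\<^bsub>affine_C n\<^esub> x \<otimes>\<^bsub>affine_C n\<^esub> g)"
proof -
  interpret group "affine_C n" by (rule group_affine_C)
  interpret commuting_pair n x x by fact
  define g where "g = perm_elem (transpose b c)"
  define y where "y = inv\<^bsub>affine_C n\<^esub> g \<otimes>\<^bsub>affine_C n\<^esub> x \<otimes>\<^bsub>affine_C n\<^esub> g"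
  define a where "a = \<bar>fst x b\<bar>"
  have b: "b \<in> {1..int n}" using a by (simp add: moved_set_def)
  have am: "a \<in> moved_set n x" using moved_set_invariant[OF b] a by (simp add: a_def)
  have ab: "a \<in> {1..int n}" "a \<noteq> b" "\<bar>fst x a\<bar> = b"
    using a abs_range[OF b] abs_invol[OF b] by (auto simp: a_def moved_set_def)
  have ne: "a \<noteq> c" "b \<noteq> c" using am a c by auto
  have g: "g \<in> carrier (affine_C n)" unfolding g_def by (rule transpose_elem_carrier[OF b c(1)])
  have yc: "y \<in> carrier (affine_C n)" using g x by (simp add: y_def)
  have "g \<otimes>\<^bsub>affine_C n\<^esub> y = x \<otimes>\<^bsub>affine_C n\<^esub> g"
    using conj_eq_iff[OF x yc g] by (simp add: y_def)
  note eq = affine_C_mult_eqD(1)[OF g yc x g this]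
  have abs_g: "\<bar>fst g k\<bar> = transpose b c \<bar>k\<bar>" if "\<bar>k\<bar> \<in> {1..int n}" for k
  proof -
    have "0 < transpose b c \<bar>k\<bar>" using that b c by (auto simp: transpose_def)
    then show ?thesis using that by (auto simp: g_def perm_elem_def abs_mult sgn_if)
  qed
  have "\<bar>fst y \<bar>fst g k\<bar>\<bar> = transpose b c \<bar>fst x k\<bar>" if "k \<in> {1..int n}" for k
    using eq[OF that] abs_fst_abs[OF yc] abs_g[OF abs_range(1)[OF that]] by simp
  from this[OF ab(1)] this[OF b] have "\<bar>fst y a\<bar> = c" "\<bar>fst y c\<bar> = a"
    using ab b ne by (simp_all add: abs_g a_def[symmetric] transpose_def split: if_splits)
  then have "a \<in> moved_set n y" "c \<in> moved_set n y"
    using ab c ne by (auto simp: moved_set_def)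
  with that g am show thesis unfolding y_def by blast
qed

text \<open>A unit translation moves the centre by 1, and the entry is twice the centre.\<close>

lemma conj_shift:
  assumes x: "x \<in> carrier (affine_C n)" and i: "i \<in> neg_set n b x"
  defines "y \<equiv> inv\<^bsub>affine_C n\<^esub> shift_elem i \<otimes>\<^bsub>affine_C n\<^esub> x \<otimes>\<^bsub>affine_C n\<^esub> shift_elem i"
  shows "fst y i = - i" "snd y i = snd x i + 2"
proof -
  interpret group "affine_C n" by (rule group_affine_C)
  have i': "i \<in> {1..int n}" "fst x i = - i" using i by (auto simp: neg_set_def)
  have g: "shift_elem i \<in> carrier (affine_C n)" by (rule shift_elem_carrier[OF i'(1)])
  have yc: "y \<in> carrier (affine_C n)" using g x by (simp add: y_def)
  have "shift_elem i \<otimes>\<^bsub>affine_C n\<^esub> y = x \<otimes>\<^bsub>affine_C n\<^esub> shift_elem i"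
    using conj_eq_iff[OF x yc g] by (simp add: y_def)
  note eq = affine_C_mult_eqD[OF g yc x g this i'(1)]
  from eq(1) show "fst y i = - i" using i' by simp
  with eq(2) show "snd y i = snd x i + 2" using i' odd_ext_pos[of i "snd x"] odd_ext_pos[of i "snd y"] by simp
qed

section \<open>Invariants of the exceptional classes\<close>

locale involution_class =
  fixes n :: nat and x :: "(int \<Rightarrow> int) \<times> (int \<Rightarrow> int)" and m k\<^sub>e k\<^sub>o l :: nat
  assumes x: "x \<in> carrier (affine_C n)" and xx: "x \<otimes>\<^bsub>affine_C n\<^esub> x = \<one>\<^bsub>affine_C n\<^esub>"
    and type: "labelled_cycle_type n x = (m, k\<^sub>e, k\<^sub>o, l)"
begin

sublocale group "affine_C n" by (rule group_affine_C)

abbreviation "X \<equiv> conjugacy_class (affine_C n) x"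

lemma class_props:
  assumes "y \<in> X"
  shows "y \<in> carrier (affine_C n)" "y \<otimes>\<^bsub>affine_C n\<^esub> y = \<one>\<^bsub>affine_C n\<^esub>"
    "card (two_cycles n (fst y)) = m" "card (neg_set n True y) = k\<^sub>e" "card (neg_set n False y) = k\<^sub>o"
    "card (fixed_set n y) = l"
proof -
  show "y \<in> carrier (affine_C n)" by (rule conjugacy_class_carrier[OF x assms])
  obtain g where g: "g \<in> carrier (affine_C n)"
    "y = inv\<^bsub>affine_C n\<^esub> g \<otimes>\<^bsub>affine_C n\<^esub> x \<otimes>\<^bsub>affine_C n\<^esub> g"
    using assms by (auto simp: conjugacy_class_def)
  then show "y \<otimes>\<^bsub>affine_C n\<^esub> y = \<one>\<^bsub>affine_C n\<^esub>"
    using conj_hom[OF x x g(1)] by (simp add: xx)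
  show "card (two_cycles n (fst y)) = m" "card (neg_set n True y) = k\<^sub>e" "card (neg_set n False y) = k\<^sub>o"
    "card (fixed_set n y) = l"
    using labelled_cycle_type_conjugate[OF x assms] type by (simp_all add: labelled_cycle_type_sets)
qed

lemma commuting_pairI:
  "y \<in> X \<Longrightarrow> z \<in> X \<Longrightarrow> y \<otimes>\<^bsub>affine_C n\<^esub> z = z \<otimes>\<^bsub>affine_C n\<^esub> y \<Longrightarrow> commuting_pair n y z"
  using class_props by unfold_locales auto

lemma x_X: "x \<in> X" by (rule conjugacy_class_self[OF x])

lemma pair_self: "y \<in> X \<Longrightarrow> commuting_pair n y y"
  by (rule commuting_pairI) auto

lemma moved_empty: "y \<in> X \<Longrightarrow> moved_set n y = {} \<longleftrightarrow> m = 0"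
  using moved_set_empty_iff[OF pair_self] class_props(3) by metis

lemma fixed_empty: "y \<in> X \<Longrightarrow> fixed_set n y = {} \<longleftrightarrow> l = 0"
  using class_props(6)[of y] finite_sets(3)[of n y] by auto

lemma card_neg_set: "y \<in> X \<Longrightarrow> card (neg_set n b y) = (if b then k\<^sub>e else k\<^sub>o)"
  using class_props(4,5) by (cases b) auto

text \<open>All conjugates are point reflections, and distinct point reflections do not commute.
  Twice the first coordinate of the centre already serves as the invariant.\<close>

lemma disconnected_all_negated:
  assumes "1 \<le> n" "m = 0" "l = 0"
  shows "\<not> connected (with_proj (commuting_graph (affine_C n) X))"
proof -
  have neg: "fst y k = - k" if "y \<in> X" "k \<in> {1..int n}" for y k
  proof -
    have "k \<notin> moved_set n y" "k \<notin> fixed_set n y"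
      using moved_empty[OF that(1)] fixed_empty[OF that(1)] assms by simp_all
    then show ?thesis using that(2) by (auto simp: moved_set_def fixed_set_def)
  qed
  have 1: "1 \<in> {1..int n}" using assms by simp
  show ?thesis
  proof (rule not_connected_commuting_graphI[OF x shift_elem_carrier[OF 1]])
    have "1 \<in> neg_set n (even (snd x 1)) x" using neg[OF x_X 1] 1 by (simp add: neg_set_def)
    from conj_shift(2)[OF x this]
    show "snd (inv\<^bsub>affine_C n\<^esub> shift_elem 1 \<otimes>\<^bsub>affine_C n\<^esub> x \<otimes>\<^bsub>affine_C n\<^esub> shift_elem 1) 1 \<noteq> snd x 1"
      by simp
  next
    fix y z assume yz: "y \<in> X" "z \<in> X" "y \<otimes>\<^bsub>affine_C n\<^esub> z = z \<otimes>\<^bsub>affine_C n\<^esub> y"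
    interpret commuting_pair n y z by (rule commuting_pairI[OF yz])
    have "1 \<in> neg_set n (even (snd y 1)) y" using neg[OF yz(1) 1] 1 by (simp add: neg_set_def)
    from neg_set_invariant(2)[OF this neg[OF yz(2) 1]] show "snd y 1 = snd z 1" by simp
  qed
qed

text \<open>A commuting conjugate preserves the only reflected coordinate of parity b and, having no
  fixed coordinates, reflects it too, about the same centre. The invariant is a set with one pair,
  so that this coordinate need not be chosen.\<close>

lemma disconnected_unique_negated:
  assumes "l = 0" "k\<^sub>e = 1 \<and> b \<or> k\<^sub>o = 1 \<and> \<not> b"
  shows "\<not> connected (with_proj (commuting_graph (affine_C n) X))"
proof -
  let ?f = "\<lambda>y. {(i, snd y i) |i. i \<in> neg_set n b y}"
  have card1: "card (neg_set n b y) = 1" if "y \<in> X" for y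
    using card_neg_set[OF that] assms(2) by auto
  have sub: "?f y \<subseteq> ?f z" if yz: "y \<in> X" "z \<in> X" "y \<otimes>\<^bsub>affine_C n\<^esub> z = z \<otimes>\<^bsub>affine_C n\<^esub> y" for y z
  proof
    interpret commuting_pair n y z by (rule commuting_pairI[OF yz])
    fix q assume "q \<in> ?f y"
    then obtain i where i: "i \<in> neg_set n b y" and q: "q = (i, snd y i)" by blast
    have i_n: "i \<in> {1..int n}" using i by (simp add: neg_set_def)
    have "\<bar>fst z i\<bar> = i"
      using neg_set_invariant(1)[OF i] i card1[OF yz(1)] by (metis card_1_singletonE singletonD)
    moreover have "fst z i \<noteq> i" using fixed_empty[OF yz(2)] assms(1) i_n by (auto simp: fixed_set_def)
    ultimately have zi: "fst z i = - i" by linarith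
    from neg_set_invariant(2)[OF i zi] have "snd z i = snd y i" .
    with zi i show "q \<in> ?f z" by (auto simp: neg_set_def q)
  qed
  obtain i where i: "neg_set n b x = {i}" using card1[OF x_X] by (rule card_1_singletonE)
  then have i': "i \<in> neg_set n b x" "i \<in> {1..int n}" by (auto simp: neg_set_def)
  let ?g = "shift_elem i"
  show ?thesis
  proof (rule not_connected_commuting_graphI[OF x shift_elem_carrier[OF i'(2)], where f = ?f])
    let ?y = "inv\<^bsub>affine_C n\<^esub> ?g \<otimes>\<^bsub>affine_C n\<^esub> x \<otimes>\<^bsub>affine_C n\<^esub> ?g"
    have "(i, snd x i + 2) \<in> ?f ?y"
      using conj_shift[OF x i'(1)] i' by (auto simp: neg_set_def)
    moreover have "(i, snd x i + 2) \<notin> ?f x" by auto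
    ultimately show "?f ?y \<noteq> ?f x" by blast
  next
    fix y z assume "y \<in> X" "z \<in> X" "y \<otimes>\<^bsub>affine_C n\<^esub> z = z \<otimes>\<^bsub>affine_C n\<^esub> y"
    then show "?f y = ?f z" using sub[of y z] sub[of z y] by simp
  qed
qed

text \<open>\<open>sep\<close> asks f to tell x from every element whose moved set meets that of x
  and also contains c, which is what \<open>conj_moves\<close> provides.\<close>

lemma disconnected_moved:
  assumes "b \<in> moved_set n x" "c \<in> {1..int n}" "c \<notin> moved_set n x"
    and sep: "\<And>a y. a \<in> moved_set n x \<Longrightarrow> a \<in> moved_set n y \<Longrightarrow> c \<in> moved_set n y \<Longrightarrow> f y \<noteq> f x"
    and inv: "\<And>y z. y \<in> X \<Longrightarrow> z \<in> X \<Longrightarrow> commuting_pair n y z \<Longrightarrow> f y = f z"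
  shows "\<not> connected (with_proj (commuting_graph (affine_C n) X))"
proof -
  obtain g a where g: "g \<in> carrier (affine_C n)" "a \<in> moved_set n x"
    "a \<in> moved_set n (inv\<^bsub>affine_C n\<^esub> g \<otimes>\<^bsub>affine_C n\<^esub> x \<otimes>\<^bsub>affine_C n\<^esub> g)"
    "c \<in> moved_set n (inv\<^bsub>affine_C n\<^esub> g \<otimes>\<^bsub>affine_C n\<^esub> x \<otimes>\<^bsub>affine_C n\<^esub> g)"
    using conj_moves[OF x assms(1-3) pair_self[OF x_X]] .
  show ?thesis
    by (rule not_connected_commuting_graphI[OF x g(1), where f = f, OF sep[OF g(2-4)]])
      (rule inv[OF _ _ commuting_pairI])
qed

text \<open>An unmoved coordinate of y is alone in its type, and z preserves types, so z does not
  move it either. That the maximum is 1 rather than 0 yields an unmoved coordinate c.\<close>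

lemma disconnected_small_parts:
  assumes "m > 0" "max k\<^sub>e (max k\<^sub>o l) = 1"
  shows "\<not> connected (with_proj (commuting_graph (affine_C n) X))"
proof -
  have le: "card (neg_set n b y) \<le> 1" "card (fixed_set n y) \<le> 1" if "y \<in> X" for y b
    using card_neg_set[OF that, of b] class_props(6)[OF that] assms(2) by (auto simp: max_def split: if_splits)
  have sub: "moved_set n z \<subseteq> moved_set n y" if yz: "y \<in> X" "z \<in> X" "commuting_pair n y z" for y z
  proof
    interpret commuting_pair n y z by (rule yz)
    fix i assume i: "i \<in> moved_set n z"
    then have i_n: "i \<in> {1..int n}" by (simp add: moved_set_def)
    show "i \<in> moved_set n y"
    proof (rule ccontr)
      assume "i \<notin> moved_set n y"
      then consider "i \<in> fixed_set n y" | b where "i \<in> neg_set n b y"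
        using set_cases[OF i_n] by blast
      then have "\<bar>fst z i\<bar> = i"
        using fixed_set_invariant[of i] neg_set_invariant(1)[of i] le[OF yz(1)] finite_sets
        by cases (metis card_le_Suc0_iff_eq One_nat_def)+
      with i show False by (simp add: moved_set_def)
    qed
  qed
  have "moved_set n x \<noteq> {}" using moved_empty[OF x_X] assms(1) by simp
  then obtain b where b: "b \<in> moved_set n x" by blast
  have "k\<^sub>e = 1 \<or> k\<^sub>o = 1 \<or> l = 1" using assms(2) by (auto simp: max_def split: if_splits)
  then have "neg_set n True x \<noteq> {} \<or> neg_set n False x \<noteq> {} \<or> fixed_set n x \<noteq> {}"
    using class_props(4-6)[OF x_X] by fastforce
  then obtain c where c: "c \<in> {1..int n}" "c \<notin> moved_set n x"
    by (auto simp: neg_set_def fixed_set_def moved_set_def)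
  show ?thesis
  proof (rule disconnected_moved[OF b c, where f = "moved_set n"])
    fix y z assume yz: "y \<in> X" "z \<in> X" "commuting_pair n y z"
    show "moved_set n y = moved_set n z"
      using sub[OF yz] sub[OF yz(2,1) commuting_pair.commuting_pair_sym[OF yz(3)]] by simp
  qed (use c(2) in blast)
qed

text \<open>The moved pair of z is a single orbit of z, while the moved pair of y is invariant under
  z.\<close>

lemma moved_pair_cases:
  assumes "m = 1" and yz: "y \<in> X" "z \<in> X" "commuting_pair n y z"
  shows "moved_set n z = moved_set n y \<or> moved_set n z \<inter> moved_set n y = {}"
proof -
  interpret commuting_pair n y z by fact
  have "moved_set n z \<noteq> {}" using moved_empty[OF yz(2)] assms(1) by simp
  then obtain i where i: "i \<in> moved_set n z" by blast
  have Z: "moved_set n z = {i, \<bar>fst z i\<bar>}"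
    using moved_set_pair[OF pair_self[OF yz(2)] _ i] class_props(3)[OF yz(2)] assms(1) by simp
  have inv: "\<bar>fst z i\<bar> \<in> moved_set n y \<longleftrightarrow> i \<in> moved_set n y"
    using i by (intro moved_set_invariant) (simp add: moved_set_def)
  show ?thesis
  proof (cases "i \<in> moved_set n y")
    case True
    then have "moved_set n z \<subseteq> moved_set n y" using inv Z by simp
    moreover have "card (moved_set n z) = card (moved_set n y)"
      using card_moved_set_pair[OF pair_self] class_props(3) yz assms(1) by simp
    ultimately show ?thesis using card_subset_eq[OF finite_sets(1)] by blast
  qed (use inv Z in auto)
qed

lemma card_moved: "m = 1 \<Longrightarrow> y \<in> X \<Longrightarrow> card (moved_set n y) = 2"
  using card_moved_set_pair[OF pair_self] class_props(3) by simp

lemma moved_set_sub: "moved_set n y \<subseteq> {1..int n}"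
  by (auto simp: moved_set_def)

text \<open>Among four coordinates, pairs that are equal or disjoint are equal or complementary, so
  the partition into two pairs is invariant. A pair through a and c cuts across it.\<close>

lemma disconnected_4:
  assumes "n = 4" "m = 1"
  shows "\<not> connected (with_proj (commuting_graph (affine_C n) X))"
proof -
  let ?f = "\<lambda>y. {moved_set n y, {1..int n} - moved_set n y}"
  have "moved_set n x \<noteq> {}" using moved_empty[OF x_X] assms by simp
  then obtain b where b: "b \<in> moved_set n x" by blast
  have card_compl: "card ({1..int n} - moved_set n y) = 2" if "y \<in> X" for y
    using card_moved[OF assms(2) that] moved_set_sub[of y] assms(1) finite_sets(1)
    by (simp add: card_Diff_subset)
  have "{1..int n} - moved_set n x \<noteq> {}" using card_compl[OF x_X] by (metis card.empty zero_neq_numeral)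
  then obtain c where c: "c \<in> {1..int n}" "c \<notin> moved_set n x" by blast
  show ?thesis
  proof (rule disconnected_moved[OF b c, where f = ?f])
    fix y z assume yz: "y \<in> X" "z \<in> X" "commuting_pair n y z"
    show "?f y = ?f z"
    proof (cases "moved_set n z = moved_set n y")
      case False
      then have "moved_set n z \<subseteq> {1..int n} - moved_set n y"
        using moved_pair_cases[OF assms(2) yz] moved_set_sub by blast
      then have "moved_set n z = {1..int n} - moved_set n y"
        using card_moved[OF assms(2) yz(2)] card_compl[OF yz(1)] by (intro card_subset_eq) auto
      moreover from this have "{1..int n} - moved_set n z = moved_set n y"
        using moved_set_sub[of y] by blast
      ultimately show ?thesis by blast
    qed simp
  qed (use c(2) in blast)
qed

text \<open>If y and z move the same pair, both reflected pairs stay. Otherwise z moves one of the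
  reflected pairs of y, which trades places with the moved pair. Either way the three pairs remain
  the same blocks.\<close>

lemma disconnected_6:
  assumes "n = 6" "m = 1" "k\<^sub>e = 2" "k\<^sub>o = 2"
  shows "\<not> connected (with_proj (commuting_graph (affine_C n) X))"
proof -
  let ?M = "moved_set n" and ?N = "neg_set n"
  have card_N: "card (?N b y) = 2" if "y \<in> X" for y b using card_neg_set[OF that] assms by simp
  have disj: "?M y \<inter> ?N b y = {}" "?N b y \<inter> ?N (\<not> b) y = {}" for y b
    by (auto simp: moved_set_def neg_set_def)
  have N_sub: "?N b y \<subseteq> {1..int n}" for y b by (auto simp: neg_set_def)
  have all: "?M y \<union> (?N b y \<union> ?N (\<not> b) y) = {1..int n}" if y: "y \<in> X" for y b
  proof (rule card_subset_eq)
    show "?M y \<union> (?N b y \<union> ?N (\<not> b) y) \<subseteq> {1..int n}" using moved_set_sub N_sub by blast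
    have "card (?M y \<union> (?N b y \<union> ?N (\<not> b) y)) = card (?M y) + (card (?N b y) + card (?N (\<not> b) y))"
      using disj finite_sets by (subst card_Un_disjoint; (subst card_Un_disjoint)?) (auto simp: Int_Un_distrib)
    then show "card (?M y \<union> (?N b y \<union> ?N (\<not> b) y)) = card {1..int n}"
      using card_moved[OF assms(2) y] card_N[OF y] assms(1) by simp
  qed simp
  have nfix: "fst y i \<noteq> i" if "y \<in> X" "i \<in> {1..int n}" for y i
  proof -
    have "i \<in> ?M y \<union> (?N True y \<union> ?N (\<not> True) y)" unfolding all[OF that(1)] by (rule that(2))
    then show ?thesis using that(2) by (auto simp: moved_set_def neg_set_def)
  qed
  let ?f = "\<lambda>y. {?M y, ?N True y, ?N False y}"
  \<comment> \<open>Having no fixed coordinates, z reflects the coordinates of this pair, and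
    commuting with y forces the same centre, hence the same parity.\<close>
  have keep: "?N b z = ?N b y"
    if yz: "y \<in> X" "z \<in> X" "commuting_pair n y z" and M: "?M z \<inter> ?N b y = {}" for y z b
  proof -
    interpret commuting_pair n y z by fact
    have "?N b y \<subseteq> ?N b z"
    proof
      fix i assume i: "i \<in> ?N b y"
      then have "i \<in> {1..int n}" "i \<notin> ?M z" using M by (auto simp: neg_set_def)
      with nfix[OF yz(2), of i] have "fst z i = - i" by (auto simp: moved_set_def)
      with neg_set_invariant(2)[OF i this] i show "i \<in> ?N b z" by (simp add: neg_set_def)
    qed
    then show ?thesis
      using card_N yz by (intro card_subset_eq[OF finite_sets(2), symmetric]) auto
  qed
  have "?M x \<noteq> {}" using moved_empty[OF x_X] assms by simp
  then obtain b where b: "b \<in> ?M x" by blast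
  have "?N True x \<noteq> {}" using card_N[OF x_X, of True] by auto
  then obtain c where "c \<in> ?N True x" by blast
  then have c: "c \<in> {1..int n}" "c \<notin> ?M x" by (auto simp: neg_set_def moved_set_def)
  show ?thesis
  proof (rule disconnected_moved[OF b c, where f = ?f])
    fix y z assume yz: "y \<in> X" "z \<in> X" "commuting_pair n y z"
    interpret commuting_pair n y z by (rule yz)
    from moved_pair_cases[OF assms(2) yz]
    consider "?M z = ?M y" | "?M z \<inter> ?M y = {}" by blast
    then show "?f y = ?f z"
    proof cases
      case 1
      then have "?N b z = ?N b y" for b using keep[OF yz] disj(1)[of y] by blast
      with 1 show ?thesis by simp
    next
      case 2
      have "?M z \<noteq> {}" using moved_empty[OF yz(2)] assms by simp
      then obtain i where i: "i \<in> ?M z" by blast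
      then have "i \<in> {1..int n}" "i \<notin> ?M y" using 2 moved_set_sub by blast+
      then obtain b where ib: "i \<in> ?N b y" using all[OF yz(1), of True] by blast
      have "?M z = {i, \<bar>fst z i\<bar>}"
        using moved_set_pair[OF pair_self[OF yz(2)] _ i] class_props(3)[OF yz(2)] assms(2) by simp
      then have "?M z \<subseteq> ?N b y" using ib neg_set_invariant(1)[OF ib] by simp
      then have Mz: "?M z = ?N b y"
        using card_moved[OF assms(2) yz(2)] card_N[OF yz(1)] by (intro card_subset_eq[OF finite_sets(2)]) auto
      have Nz: "?N (\<not> b) z = ?N (\<not> b) y"
        using disj(2)[of b y] Mz by (intro keep[OF yz]) auto
      \<comment> \<open>The pair left over for z is the one that y moves.\<close>
      have "?N b z = {1..int n} - ?M z - ?N (\<not> b) z"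
        unfolding all[OF yz(2), of b, symmetric] using disj(1)[of z b] disj(2)[of b z] by blast
      moreover have "?M y = {1..int n} - ?N b y - ?N (\<not> b) y"
        unfolding all[OF yz(1), of b, symmetric]
        using disj(1)[of y b] disj(1)[of y "\<not> b"] by blast
      ultimately have Nb: "?N b z = ?M y" using Mz Nz by simp
      show ?thesis
      proof (cases b)
        case True
        with Mz Nz Nb show ?thesis by (simp add: insert_commute)
      next
        case False
        with Mz Nz Nb show ?thesis by (simp add: insert_commute)
      qed
    qed
  next
    fix a y assume a: "a \<in> ?M x" "a \<in> ?M y" "c \<in> ?M y"
    then have "?M y \<noteq> ?M x" using c(2) by blast
    moreover have "?M y \<noteq> ?N b x" for b using a disj(1)[of x b] by blast
    ultimately show "?f y \<noteq> ?f x" by (metis insertE insertI1 singletonD)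
  qed
qed

end

theorem theorem1p2:
  fixes n m k\<^sub>e k\<^sub>o l :: nat
    and x :: "(int \<Rightarrow> int) \<times> (int \<Rightarrow> int)"
    and X :: "((int \<Rightarrow> int) \<times> (int \<Rightarrow> int)) set"
  assumes "n \<ge> 2"
    and "x \<in> carrier (affine_C n)"
    and "group.ord (affine_C n) x = 2"
    and "X = conjugacy_class (affine_C n) x"
    and "labelled_cycle_type n x = (m, k\<^sub>e, k\<^sub>o, l)"
  shows "\<not> connected (with_proj (commuting_graph (affine_C n) X)) \<longleftrightarrow>
      (m = 0 \<and> l = 0)
    \<or> (m > 0 \<and> l = 0 \<and> (k\<^sub>e = 1 \<or> k\<^sub>o = 1))
    \<or> (m > 0 \<and> max k\<^sub>e (max k\<^sub>o l) = 1)
    \<or> (n = 4 \<and> m = 1)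
    \<or> (n = 6 \<and> m = 1 \<and> k\<^sub>e = 2 \<and> k\<^sub>o = 2)" (is "\<not> ?C \<longleftrightarrow> ?D")
proof -
  interpret group "affine_C n" by (rule group_affine_C)
  have "x [^]\<^bsub>affine_C n\<^esub> (2::nat) = \<one>\<^bsub>affine_C n\<^esub>"
    using pow_ord_eq_1[OF assms(2)] assms(3) by simp
  then have xx: "x \<otimes>\<^bsub>affine_C n\<^esub> x = \<one>\<^bsub>affine_C n\<^esub>"
    using assms(2) by (simp add: numeral_2_eq_2)
  interpret involution_class n x m k\<^sub>e k\<^sub>o l
    by unfold_locales (fact assms xx)+
  have disc: "\<not> ?C" if ?D
  proof -
    have "1 \<le> n" using assms(1) by simp
    with that show ?thesis
      unfolding assms(4)
      by (elim disjE conjE)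
        (rule disconnected_all_negated disconnected_unique_negated[of True]
          disconnected_unique_negated[of False] disconnected_small_parts disconnected_4
          disconnected_6; simp)+
  qed
  have conn: ?C if nD: "\<not> ?D"
  proof -
    obtain g p R D where g: "g \<in> carrier (affine_C n)" and N: "normal_data n p R D"
      and eq: "g \<otimes>\<^bsub>affine_C n\<^esub> normal_elem p R D = x \<otimes>\<^bsub>affine_C n\<^esub> g"
      using involution_normal_form[OF assms(2) xx] .
    interpret N: normal_data n p R D by (rule N)
    \<comment> \<open>Passing to the normal form changes neither the class nor its labelled cycle
      type.\<close>
    have y: "inv\<^bsub>affine_C n\<^esub> g \<otimes>\<^bsub>affine_C n\<^esub> x \<otimes>\<^bsub>affine_C n\<^esub> g = normal_elem p R D"
      using conj_eq_iff[OF assms(2) N.normal_elem_carrier g] eq by simp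
    then have X: "X = conjugacy_class (affine_C n) (normal_elem p R D)"
      using conjugacy_class_eq[OF assms(2) g] assms(4) by simp
    have "normal_elem p R D \<in> conjugacy_class (affine_C n) x"
      using conjugacy_class_conj[OF assms(2) x_X g] y by simp
    from labelled_cycle_type_conjugate[OF assms(2) this]
    have t: "labelled_cycle_type n (normal_elem p R D) = (m, k\<^sub>e, k\<^sub>o, l)" using assms(5) by simp
    show ?C
      unfolding X
    proof (rule N.connected_normal[OF _ t])
      show "1 \<le> n" using assms(1) by simp
    qed (use nD in blast)+
  qed
  show ?thesis
    by (rule iffI, rule ccontr, erule notE, erule conn) (erule disc)
qed

end
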